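(* Let $F_7$ be the Fano matroid and $F_7^*$ its dual. Then: (1) $F_7$ is $C$-Gårding. (2) $F_7^*$ is $S$-Gårding and $B$-Gårding. (3) Both $F_7$ and $F_7^*$ are $C$-Rayleigh, $S$-Rayleigh, $B$-Rayleigh and $I$-Rayleigh.
   Context: $F_7$ is the rank-3 matroid on $\{1,\dots,7\}$ whose bases are the 3-element subsets other than the seven lines $\{1,2,3\},\{1,4,5\},\{1,6,7\},\{2,4,6\},\{2,5,7\},\{3,4,7\},\{3,5,6\}$. For a matroid $M$ on $E$, variables $w=(w_e)_{e\in E}$ and $w_T=\prod_{e\in T}w_e$, put $I_M=\sum_{I\text{ independent}}w_I$, $B_M=\sum_{B\text{ basis}}w_B$, $S_M=\sum_{T\text{ spanning}}w_T$ ($T$ is spanning if it contains a basis), $C_M=\sum_{X\subseteq E,\ E\setminus X\text{ independent}}w_X$. For $X\in\{I,B,S,C\}$, $M$ is $X$-Gårding (resp. $X$-Rayleigh) if $X_M$ is Gårding (resp. Rayleigh). Let $\Gamma_n^+=\{x\in\mathbb{R}^n:x_i>0\ \forall i\}$. A nonzero multi-affine polynomial $f$ is Gårding if some nonempty connected component $R$ of $\{f>0\}$ satisfies $R+\overline{\Gamma_n^+}\subset R$. A multi-affine polynomial $f$ with nonnegative coefficients is Rayleigh if $f\,\partial_i\partial_jf-\partial_if\,\partial_jf\le0$ on $\Gamma_n^+$ for all $i\neq j$. *)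

theory Defs
  imports "HOL-Analysis.Analysis"
begin

text \<open>
  A matroid on the finite ground set \<open>UNIV :: 'n set\<close>, given by its family of bases.
\<close>

typedef (overloaded) ('n::finite) matroid =
  "{\<B> :: 'n set set. \<B> \<noteq> {} \<and>
     (\<forall>A\<in>\<B>. \<forall>B\<in>\<B>. \<forall>x\<in>A - B. \<exists>y\<in>B - A. insert y (A - {x}) \<in> \<B>)}"
  morphisms bases Abs_matroid
  by (rule exI[of _ "{{}}"]) simp

lemma bases_nonempty: "bases M \<noteq> {}"
  using bases[of M] by simp

lemma bases_exchange:
  assumes "A \<in> bases M" "B \<in> bases M" "x \<in> A" "x \<notin> B"
  shows "\<exists>y. y \<in> B \<and> y \<notin> A \<and> insert y (A - {x}) \<in> bases M"
  using bases[of M] assms by blast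

definition indep :: "('n::finite) matroid \<Rightarrow> 'n set \<Rightarrow> bool"
  where "indep M T \<longleftrightarrow> (\<exists>B\<in>bases M. T \<subseteq> B)"

definition spanning :: "('n::finite) matroid \<Rightarrow> 'n set \<Rightarrow> bool"
  where "spanning M T \<longleftrightarrow> (\<exists>B\<in>bases M. B \<subseteq> T)"

definition dual :: "('n::finite) matroid \<Rightarrow> 'n matroid"
  where "dual M = Abs_matroid (uminus ` bases M)"

text \<open>
  The following lemmas show that the bases of \<open>dual M\<close> really are the complements of the
  bases of \<open>M\<close>.
\<close>

lemma bases_card_le:
  assumes "A \<in> bases M" "B \<in> bases M"
  shows "card A \<le> card B"
  using assms
proof (induction "card (A - B)" arbitrary: A)
  case 0
  then show ?case by (simp add: card_mono)
next
  case (Suc n)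
  then have "card (A - B) \<noteq> 0" by linarith
  then have "\<not> A \<subseteq> B" by simp
  then obtain x where x: "x \<in> A" "x \<notin> B" by blast
  obtain y where y: "y \<in> B" "y \<notin> A" "insert y (A - {x}) \<in> bases M"
    using bases_exchange[OF Suc.prems x] by blast
  have "insert y (A - {x}) - B = (A - B) - {x}"
    using y by auto
  then have "card (insert y (A - {x}) - B) = n"
    using Suc.hyps(2) x by simp
  then have "card (insert y (A - {x})) \<le> card B"
    using Suc.hyps(1) y(3) Suc.prems(2) by blast
  moreover have "card (insert y (A - {x})) = card A"
    using x y card_Suc_Diff1[of A x] by simp
  ultimately show ?case by simp
qed

lemma bases_card_eq:
  assumes "A \<in> bases M" "B \<in> bases M"
  shows "card A = card B"
  using bases_card_le[OF assms] bases_card_le[OF assms(2,1)] by (rule order_antisym)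

lemma bases_dual_exchange:
  assumes A: "A \<in> bases M" and B: "B \<in> bases M" and x: "x \<in> B" "x \<notin> A"
  shows "\<exists>y. y \<in> A \<and> y \<notin> B \<and> insert x (A - {y}) \<in> bases M"
proof -
  let ?P = "\<lambda>D. D \<in> bases M \<and> insert x (A \<inter> B) \<subseteq> D"
  have "?P B" using B x by auto
  moreover have "\<forall>D. ?P D \<longrightarrow> card (D \<inter> A) < Suc (card A)"
    by (simp add: card_mono less_Suc_eq_le)
  ultimately obtain D where D: "?P D" and max: "\<And>D'. ?P D' \<Longrightarrow> card (D' \<inter> A) \<le> card (D \<inter> A)"
    using ex_has_greatest_nat[of ?P B "\<lambda>D. card (D \<inter> A)"] by (metis (no_types, lifting))
  have sub: "D \<subseteq> insert x A"
  proof (rule ccontr)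
    assume "\<not> D \<subseteq> insert x A"
    then obtain z where z: "z \<in> D" "z \<notin> A" "z \<noteq> x" by auto
    obtain w where w: "w \<in> A" "w \<notin> D" "insert w (D - {z}) \<in> bases M"
      using bases_exchange[OF conjunct1[OF D] A z(1,2)] by blast
    have "?P (insert w (D - {z}))"
      using D z w by auto
    then have "card (insert w (D - {z}) \<inter> A) \<le> card (D \<inter> A)"
      by (rule max)
    moreover have "insert w (D - {z}) \<inter> A = insert w (D \<inter> A)"
      using z w by auto
    ultimately show False using w by simp
  qed
  have cD: "card D = card A" using bases_card_eq D A by blast
  have xD: "x \<in> D" using D by blast
  have "\<not> A \<subseteq> D"
  proof
    assume "A \<subseteq> D"
    then have "A = D" using cD by (simp add: card_subset_eq)
    then show False using x xD by simp
  qed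
  then obtain y where y: "y \<in> A" "y \<notin> D" by auto
  have "D \<subseteq> insert x (A - {y})" using sub y by auto
  moreover have "card (insert x (A - {y})) = card D"
    using cD x y card_Suc_Diff1[of A y] by simp
  ultimately have "D = insert x (A - {y})"
    by (metis card_subset_eq finite)
  then show ?thesis using D y by auto
qed

lemma bases_dual: "bases (dual M) = uminus ` bases M"
proof -
  have "\<exists>y\<in>B' - A'. insert y (A' - {x}) \<in> uminus ` bases M"
    if A': "A' \<in> uminus ` bases M" and B': "B' \<in> uminus ` bases M" and x: "x \<in> A' - B'"
    for A' B' x
  proof -
    from A' B' obtain A B where AB: "A \<in> bases M" "B \<in> bases M" "A' = - A" "B' = - B"
      by blast
    then obtain y where y: "y \<in> A" "y \<notin> B" "insert x (A - {y}) \<in> bases M"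
      using bases_dual_exchange[OF AB(1,2), of x] x by auto
    have "insert y (A' - {x}) = - insert x (A - {y})"
      using AB x y by auto
    then show ?thesis using y AB by blast
  qed
  then show ?thesis
    unfolding dual_def by (subst Abs_matroid_inverse) (simp_all add: bases_nonempty)
qed

text \<open>
  The Fano matroid. In the seven-element type \<open>7\<close> the numerals \<open>1, \<dots>, 7\<close> are pairwise
  distinct and exhaust the type (the element \<open>7\<close> is the same as \<open>0\<close>).
\<close>

definition fano_lines :: "7 set set"
  where "fano_lines =
    {{1, 2, 3}, {1, 4, 5}, {1, 6, 7}, {2, 4, 6}, {2, 5, 7}, {3, 4, 7}, {3, 5, 6}}"

definition fano :: "7 matroid"
  where "fano = Abs_matroid {B. card B = 3 \<and> B \<notin> fano_lines}"

lemma UNIV_7: "(UNIV :: 7 set) = {1, 2, 3, 4, 5, 6, 7}"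
  by (rule sym, rule card_subset_eq) simp_all

lemma fano_lines_card: "L \<in> fano_lines \<Longrightarrow> card L = 3"
  unfolding fano_lines_def by auto

lemma fano_lines_ex:
  fixes a b :: 7
  shows "\<exists>L\<in>fano_lines. a \<in> L \<and> b \<in> L"
proof -
  have "\<forall>a\<in>{1, 2, 3, 4, 5, 6, 7}. \<forall>b\<in>{1, 2, 3, 4, 5, 6, 7}. \<exists>L\<in>fano_lines. a \<in> L \<and> b \<in> L"
    unfolding fano_lines_def by simp
  then show ?thesis
    unfolding UNIV_7[symmetric] by blast
qed

lemma fano_lines_inter:
  assumes "L \<in> fano_lines" "L' \<in> fano_lines"
  shows "L = L' \<or> card (L \<inter> L') = 1"
proof -
  have "\<forall>L\<in>fano_lines. \<forall>L'\<in>fano_lines. L = L' \<or> card (L \<inter> L') = 1"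
    unfolding fano_lines_def by simp
  then show ?thesis using assms by blast
qed

lemma fano_lines_unique:
  assumes "L \<in> fano_lines" "L' \<in> fano_lines" "a \<in> L" "b \<in> L" "a \<in> L'" "b \<in> L'" "a \<noteq> b"
  shows "L = L'"
proof (rule ccontr)
  assume "L \<noteq> L'"
  then have "card (L \<inter> L') = 1" using fano_lines_inter assms(1,2) by blast
  then obtain c where "L \<inter> L' = {c}" by (auto simp: card_1_singleton_iff)
  then show False using assms(3-7) by (metis IntI singletonD)
qed

lemma bases_fano: "bases fano = {B. card B = 3 \<and> B \<notin> fano_lines}"
proof -
  let ?\<B> = "{B :: 7 set. card B = 3 \<and> B \<notin> fano_lines}"
  have "\<exists>y\<in>B - A. insert y (A - {x}) \<in> ?\<B>"
    if A: "A \<in> ?\<B>" and B: "B \<in> ?\<B>" and x: "x \<in> A - B" for A B x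
  proof -
    have "card (A - {x}) = 2" using A x by simp
    then obtain a b where ab: "A - {x} = {a, b}" "a \<noteq> b"
      by (meson card_2_iff)
    obtain L where L: "L \<in> fano_lines" "a \<in> L" "b \<in> L"
      using fano_lines_ex by blast
    have "\<not> B \<subseteq> L"
      using L(1) B fano_lines_card[OF L(1)] card_subset_eq[of L B] by auto
    then obtain y where y: "y \<in> B" "y \<notin> L" by blast
    have ne: "y \<noteq> a" "y \<noteq> b" "y \<noteq> x" using y L x by auto
    then have "y \<notin> A" using ab by auto
    moreover have "card {y, a, b} = 3" using ne ab by simp
    moreover have "{y, a, b} \<notin> fano_lines"
      using fano_lines_unique[OF L(1) _ L(2,3) _ _ ab(2)] y(2) by blast
    ultimately show ?thesis using y(1) ab(1) by auto
  qed
  moreover have "{1, 2, 4} \<in> ?\<B>"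
  proof -
    have "{1, 2, 3} \<in> fano_lines" unfolding fano_lines_def by blast
    then have "{1, 2, 4} \<in> fano_lines \<Longrightarrow> {1, 2, 4} = {1, 2, 3 :: 7}"
      by (rule fano_lines_unique[of _ _ 1 2, rotated]) simp_all
    moreover have "{1, 2, 4} \<noteq> {1, 2, 3 :: 7}"
    proof
      assume "{1, 2, 4} = {1, 2, 3 :: 7}"
      then have "4 \<in> {1, 2, 3 :: 7}" by blast
      then show False by simp
    qed
    ultimately show ?thesis by auto
  qed
  ultimately have "?\<B> \<noteq> {} \<and>
     (\<forall>A\<in>?\<B>. \<forall>B\<in>?\<B>. \<forall>x\<in>A - B. \<exists>y\<in>B - A. insert y (A - {x}) \<in> ?\<B>)"
    by (metis (no_types, lifting) empty_iff)
  then show ?thesis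
    unfolding fano_def by (intro Abs_matroid_inverse CollectI)
qed

text \<open>
  Polynomials in the variables \<open>w\<^sub>e\<close>, for \<open>e\<close> ranging over the ground set, are represented by
  their polynomial functions on \<open>\<real>\<^sup>n\<close>; for real coefficients this loses nothing.
\<close>

definition mono_prod :: "'n set \<Rightarrow> real ^ 'n::finite \<Rightarrow> real"
  where "mono_prod T w = (\<Prod>e\<in>T. w $ e)"

definition multi_affine :: "(real ^ 'n::finite \<Rightarrow> real) \<Rightarrow> bool"
  where "multi_affine f \<longleftrightarrow>
    (\<exists>c :: 'n set \<Rightarrow> real. \<forall>w. f w = (\<Sum>T\<in>UNIV. c T * mono_prod T w))"

definition multi_affine_nonneg :: "(real ^ 'n::finite \<Rightarrow> real) \<Rightarrow> bool"
  where "multi_affine_nonneg f \<longleftrightarrow>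
    (\<exists>c :: 'n set \<Rightarrow> real. (\<forall>T. 0 \<le> c T) \<and> (\<forall>w. f w = (\<Sum>T\<in>UNIV. c T * mono_prod T w)))"

definition partial_deriv :: "'n \<Rightarrow> (real ^ 'n::finite \<Rightarrow> real) \<Rightarrow> real ^ 'n \<Rightarrow> real"
  where "partial_deriv i f w = deriv (\<lambda>t. f (w + t *\<^sub>R axis i 1)) 0"

definition pos_orthant :: "(real ^ 'n::finite) set"
  where "pos_orthant = {x. \<forall>i. 0 < x $ i}"

text \<open>Members of \<^const>\<open>components\<close> are nonempty by definition.\<close>

definition garding :: "(real ^ 'n::finite \<Rightarrow> real) \<Rightarrow> bool"
  where "garding f \<longleftrightarrow> multi_affine f \<and> f \<noteq> (\<lambda>w. 0) \<and>
    (\<exists>R\<in>components {w. 0 < f w}. {x + y | x y. x \<in> R \<and> y \<in> closure pos_orthant} \<subseteq> R)"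

definition rayleigh :: "(real ^ 'n::finite \<Rightarrow> real) \<Rightarrow> bool"
  where "rayleigh f \<longleftrightarrow> multi_affine_nonneg f \<and>
    (\<forall>i j. i \<noteq> j \<longrightarrow> (\<forall>w\<in>pos_orthant.
      f w * partial_deriv i (partial_deriv j f) w - partial_deriv i f w * partial_deriv j f w \<le> 0))"

definition I_poly :: "('n::finite) matroid \<Rightarrow> real ^ 'n \<Rightarrow> real"
  where "I_poly M w = (\<Sum>T | indep M T. mono_prod T w)"

definition B_poly :: "('n::finite) matroid \<Rightarrow> real ^ 'n \<Rightarrow> real"
  where "B_poly M w = (\<Sum>T\<in>bases M. mono_prod T w)"

definition S_poly :: "('n::finite) matroid \<Rightarrow> real ^ 'n \<Rightarrow> real"
  where "S_poly M w = (\<Sum>T | spanning M T. mono_prod T w)"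

definition C_poly :: "('n::finite) matroid \<Rightarrow> real ^ 'n \<Rightarrow> real"
  where "C_poly M w = (\<Sum>T | indep M (- T). mono_prod T w)"

end

theory Submission
  imports Defs
begin

text \<open>
  For a multi-affine polynomial \<open>f\<close> write \<open>\<Delta>\<^sub>i\<^sub>j f = \<partial>\<^sub>i f \<partial>\<^sub>j f - f \<partial>\<^sub>i \<partial>\<^sub>j f\<close>. The Rayleigh property says
  that these differences are nonnegative on the positive orthant. The Garding property follows from
  their nonnegativity on a larger set, the cone on which \<open>f\<close> and all its nonzero iterated partial
  derivatives are positive (\<open>garding_mapoly\<close>). This cone is open, connected and stable under adding
  nonnegative vectors. If the differences are nonnegative on it, then \<open>\<partial>\<^sub>i f / f\<close> decreases in all
  nonnegative directions, so \<open>\<partial>\<^sub>i f\<close> cannot vanish at a boundary point of the cone where \<open>f > 0\<close>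
  without vanishing in the positive orthant as well. As the hypothesis passes to the derivatives of
  \<open>f\<close>, the same holds for these, and the cone is a whole component of \<open>{f > 0}\<close>.

  Reversing a polynomial, that is, complementing the exponent sets of its monomials, preserves the
  Rayleigh property (\<open>rayleigh_reverse\<close>). It exchanges \<open>I\<^sub>M\<close> with \<open>C\<^sub>M\<close>, and \<open>B\<^sub>M\<close> with the basis
  polynomial of the dual; moreover \<open>C\<^sub>M\<close> is the spanning polynomial of the dual. Only three polynomials
  remain: the cospanning polynomial \<open>C\<close> of \<open>F\<^sub>7\<close> and the basis polynomial of its dual, for which the
  differences must be nonnegative on the cone, and the spanning polynomial of \<open>F\<^sub>7\<close>, for which the
  orthant suffices.

  Since the automorphisms of the Fano plane act transitively on ordered pairs of points
  (\<open>ex_fano_labelled\<close>), there is one difference to study for each of them. It is a polynomial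
  in the weights of the five other points: \<open>x\<close> for the third point of the line through \<open>i\<close> and \<open>j\<close>, and
  \<open>a, b, c, d\<close> for the points off that line. For the basis polynomial it becomes a square plus
  \<open>4 a b c d\<close> times the coefficient of \<open>w\<^sub>i w\<^sub>j\<close>, which is nonnegative on the cone, and it is clearly
  nonnegative if \<open>a b c d \<le> 0\<close>. For the spanning polynomial it is
  nonnegative term by term. The cospanning polynomial, which is not homogeneous, requires a real
  inequality with a case distinction on signs (\<open>cospanning_rayleigh_inequality\<close>). In its delicate
  cases the difference is compared with its value at the zero in \<open>x\<close> of that same coefficient, which
  is nonnegative by the identity in \<open>cospan_disc_root_factor\<close>.
\<close>

section \<open>Multi-affine polynomials and their derivatives\<close>

definition mapoly :: "('n::finite set \<Rightarrow> real) \<Rightarrow> real ^ 'n \<Rightarrow> real"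
  where "mapoly c w = (\<Sum>T\<in>UNIV. c T * mono_prod T w)"

text \<open>
  The coefficients of the iterated partial derivative in all variables of \<open>T\<close>. Indexing by
  a set suffices, because a second derivative in the same variable vanishes.
\<close>

definition dcoef :: "'n set \<Rightarrow> ('n set \<Rightarrow> real) \<Rightarrow> 'n set \<Rightarrow> real"
  where "dcoef T c U = (if T \<inter> U = {} then c (T \<union> U) else 0)"

lemma dcoef_empty [simp]: "dcoef {} c = c"
  by (auto simp: dcoef_def)

lemma dcoef_zero [simp]: "dcoef T (\<lambda>U. 0) = (\<lambda>U. 0)"
  by (simp add: dcoef_def fun_eq_iff)

lemma dcoef_dcoef: "S \<inter> T = {} \<Longrightarrow> dcoef S (dcoef T c) = dcoef (S \<union> T) c"
  by (auto simp: dcoef_def fun_eq_iff Un_ac)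

lemma dcoef_pair: "i \<noteq> j \<Longrightarrow> dcoef {i} (dcoef {j} c) = dcoef {i, j} c"
  by (simp add: dcoef_dcoef insert_commute)

lemma dcoef_singleton_eq_0: "i \<in> T \<Longrightarrow> dcoef {i} (dcoef T c) = (\<lambda>U. 0)"
  by (auto simp: dcoef_def fun_eq_iff)

lemma mapoly_zero [simp]: "mapoly (\<lambda>U. 0) w = 0"
  by (simp add: mapoly_def)

lemma mono_prod_add_axis:
  "mono_prod U (w + t *\<^sub>R axis i 1) = mono_prod U w + (if i \<in> U then t * mono_prod (U - {i}) w else 0)"
proof -
  have *: "(\<Prod>e\<in>U - {i}. (w + t *\<^sub>R axis i 1) $ e) = (\<Prod>e\<in>U - {i}. w $ e)"
    by (rule prod.cong) (auto simp: axis_def)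
  have **: "i \<notin> U \<Longrightarrow> (\<Prod>e\<in>U. (w + t *\<^sub>R axis i 1) $ e) = (\<Prod>e\<in>U. w $ e)"
    by (rule prod.cong) (auto simp: axis_def)
  show ?thesis
    unfolding mono_prod_def
    using * ** prod.remove[of U i "\<lambda>e. w $ e"] prod.remove[of U i "\<lambda>e. (w + t *\<^sub>R axis i 1) $ e"]
    by (auto simp: axis_def algebra_simps)
qed

lemma mapoly_add_axis:
  "mapoly c (w + t *\<^sub>R axis i 1) = mapoly c w + t * mapoly (dcoef {i} c) w"
proof -
  have "(\<Sum>U\<in>UNIV. if i \<in> U then c U * mono_prod (U - {i}) w else 0)
      = (\<Sum>U | i \<in> U. c U * mono_prod (U - {i}) w)"
    by (simp add: sum.If_cases)
  also have "\<dots> = (\<Sum>U | i \<notin> U. c (insert i U) * mono_prod U w)"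
    by (rule sum.reindex_bij_witness[of _ "insert i" "\<lambda>U. U - {i}"]) (auto simp: insert_absorb)
  also have "\<dots> = (\<Sum>U\<in>UNIV. if i \<notin> U then c (insert i U) * mono_prod U w else 0)"
    by (simp add: sum.If_cases)
  also have "\<dots> = mapoly (dcoef {i} c) w"
    unfolding mapoly_def dcoef_def by (rule sum.cong) auto
  finally have *: "(\<Sum>U\<in>UNIV. if i \<in> U then c U * mono_prod (U - {i}) w else 0)
      = mapoly (dcoef {i} c) w" .
  have "mapoly c (w + t *\<^sub>R axis i 1) = (\<Sum>U\<in>UNIV. c U * mono_prod U w
      + t * (if i \<in> U then c U * mono_prod (U - {i}) w else 0))"
    unfolding mapoly_def mono_prod_add_axis by (rule sum.cong) (auto simp: algebra_simps)
  then show ?thesis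
    unfolding *[symmetric] by (simp add: sum.distrib mapoly_def sum_distrib_left)
qed

lemma mapoly_dcoef_singleton: "mapoly (dcoef {i} c) w = mapoly c (w + axis i 1) - mapoly c w"
  using mapoly_add_axis[of c w 1 i] by simp

lemma mapoly_dcoef_pair:
  assumes "i \<noteq> j"
  shows "mapoly (dcoef {i, j} c) w
    = mapoly c (w + axis i 1 + axis j 1) - mapoly c (w + axis i 1)
      - mapoly c (w + axis j 1) + mapoly c w"
  unfolding dcoef_pair[OF assms, symmetric] by (simp add: mapoly_dcoef_singleton algebra_simps)

text \<open>
  The polynomial is affine in each variable, so all differentiation is coefficient bookkeeping
  from here on, and derivatives can be computed as differences.
\<close>

lemma partial_deriv_mapoly: "partial_deriv i (mapoly c) = mapoly (dcoef {i} c)"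
proof
  fix w
  have "((\<lambda>t. mapoly c w + t * mapoly (dcoef {i} c) w) has_field_derivative mapoly (dcoef {i} c) w) (at 0)"
    by (auto intro!: derivative_eq_intros)
  then show "partial_deriv i (mapoly c) w = mapoly (dcoef {i} c) w"
    unfolding partial_deriv_def mapoly_add_axis by (rule DERIV_imp_deriv)
qed

lemma continuous_on_mapoly [continuous_intros]:
  fixes g :: "'a::topological_space \<Rightarrow> real ^ 'n::finite"
  assumes "continuous_on A g"
  shows "continuous_on A (\<lambda>w. mapoly c (g w))"
  unfolding mapoly_def mono_prod_def by (intro continuous_intros assms)

lemma mapoly_pos:
  assumes "\<And>T. 0 \<le> c T" "c \<noteq> (\<lambda>T. 0)" "w \<in> pos_orthant"
  shows "0 < mapoly c w"
proof -
  obtain T where "c T \<noteq> 0" using assms(2) by auto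
  moreover have "0 < mono_prod U w" for U
    using assms(3) unfolding mono_prod_def pos_orthant_def by (intro prod_pos) auto
  ultimately show ?thesis
    unfolding mapoly_def using assms(1)
    by (intro sum_pos2[of _ T]) (auto simp: less_le)
qed

section \<open>The Rayleigh difference\<close>

definition rayleigh_diff :: "('n::finite set \<Rightarrow> real) \<Rightarrow> 'n \<Rightarrow> 'n \<Rightarrow> real ^ 'n \<Rightarrow> real"
  where "rayleigh_diff c i j w
    = mapoly (dcoef {i} c) w * mapoly (dcoef {j} c) w - mapoly c w * mapoly (dcoef {i, j} c) w"

lemma rayleigh_mapoly_iff:
  assumes "\<And>T. 0 \<le> c T"
  shows "rayleigh (mapoly c) \<longleftrightarrow> (\<forall>i j. i \<noteq> j \<longrightarrow> (\<forall>w\<in>pos_orthant. 0 \<le> rayleigh_diff c i j w))"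
proof -
  have "multi_affine_nonneg (mapoly c)"
    unfolding multi_affine_nonneg_def mapoly_def using assms by blast
  then show ?thesis
    by (simp add: rayleigh_def partial_deriv_mapoly rayleigh_diff_def dcoef_pair cong: imp_cong)
qed

section \<open>A Rayleigh-type criterion for the Garding property\<close>

text \<open>
  A description by inequalities of the component of \<open>{f > 0}\<close> that contains the positive orthant;
  \<open>garding_mapoly\<close> identifies the two sets under its hypothesis on Rayleigh differences. Positivity cannot be asked
  of derivatives that vanish identically.
\<close>

definition garding_cone :: "('n::finite set \<Rightarrow> real) \<Rightarrow> (real ^ 'n) set"
  where "garding_cone c = {w. \<forall>T. dcoef T c \<noteq> (\<lambda>U. 0) \<longrightarrow> 0 < mapoly (dcoef T c) w}"

text \<open>
  Moving in a coordinate direction adds to each derivative a nonnegative multiple of a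
  derivative of higher order.
\<close>

lemma garding_cone_add_axis:
  assumes "w \<in> garding_cone c" "0 \<le> t"
  shows "w + t *\<^sub>R axis i 1 \<in> garding_cone c"
  unfolding garding_cone_def
proof (intro CollectI allI impI)
  fix T assume T: "dcoef T c \<noteq> (\<lambda>U. 0)"
  have pos: "0 < mapoly (dcoef T c) w" using assms T by (auto simp: garding_cone_def)
  have "0 \<le> mapoly (dcoef {i} (dcoef T c)) w"
  proof (cases "i \<in> T")
    case True
    then show ?thesis by (simp add: dcoef_singleton_eq_0)
  next
    case False
    then have eq: "dcoef {i} (dcoef T c) = dcoef (insert i T) c"
      by (subst dcoef_dcoef) auto
    show ?thesis
    proof (cases "dcoef (insert i T) c = (\<lambda>U. 0)")
      case True then show ?thesis by (simp add: eq)
    next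
      case False then show ?thesis using assms(1) by (auto simp: eq garding_cone_def less_imp_le)
    qed
  qed
  then show "0 < mapoly (dcoef T c) (w + t *\<^sub>R axis i 1)"
    unfolding mapoly_add_axis using pos assms(2) by (simp add: add_pos_nonneg)
qed

lemma orthant_direction_induct:
  fixes w y :: "real ^ 'n::finite"
  assumes y: "\<And>i. 0 \<le> y $ i"
    and base: "P w"
    and step: "\<And>v t i. P v \<Longrightarrow> 0 \<le> t \<Longrightarrow> P (v + t *\<^sub>R axis i 1)"
  shows "P (w + y)"
proof -
  have "P (w + (\<Sum>i\<in>A. y $ i *\<^sub>R axis i 1))" if "finite A" for A
    using that
  proof induction
    case empty
    then show ?case using base by simp
  next
    case (insert i A)
    then show ?case
      using step[OF insert.IH y[of i], of i] by (simp add: algebra_simps)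
  qed
  from this[OF finite[of UNIV]] show ?thesis
    using basis_expansion[of y] by (simp add: scalar_mult_eq_scaleR)
qed

lemma garding_cone_add:
  assumes "w \<in> garding_cone c" "\<And>i. 0 \<le> y $ i"
  shows "w + y \<in> garding_cone c"
  using assms(2,1) garding_cone_add_axis
  by (rule orthant_direction_induct[where P = "\<lambda>v. v \<in> garding_cone c"])

lemma pos_orthant_subset_garding_cone:
  assumes "\<And>T. 0 \<le> c T"
  shows "pos_orthant \<subseteq> garding_cone c"
  using assms by (auto simp: garding_cone_def dcoef_def intro!: mapoly_pos)

lemma open_garding_cone: "open (garding_cone c)"
proof -
  have "open {w. dcoef T c \<noteq> (\<lambda>U. 0) \<longrightarrow> 0 < mapoly (dcoef T c) w}" for T
    by (cases "dcoef T c = (\<lambda>U. 0)") (auto intro!: open_Collect_less continuous_intros)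
  then have "open (\<Inter>T. {w. dcoef T c \<noteq> (\<lambda>U. 0) \<longrightarrow> 0 < mapoly (dcoef T c) w})"
    by (intro open_INT) auto
  moreover have "(\<Inter>T. {w. dcoef T c \<noteq> (\<lambda>U. 0) \<longrightarrow> 0 < mapoly (dcoef T c) w}) = garding_cone c"
    by (auto simp: garding_cone_def)
  ultimately show ?thesis by simp
qed

text \<open>
  Two points have a common upper bound, and the segments from both of them to it only use
  nonnegative directions.
\<close>

lemma connected_garding_cone: "connected (garding_cone c)"
proof -
  have *: "\<exists>v. (\<forall>i. w $ i \<le> v $ i) \<and> (\<forall>i. w' $ i \<le> v $ i)" for w w' :: "real ^ 'a"
    by (rule exI[of _ "\<chi> i. max (w $ i) (w' $ i)"]) auto
  have seg: "closed_segment w v \<subseteq> garding_cone c"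
    if w: "w \<in> garding_cone c" and le: "\<forall>i. w $ i \<le> v $ i" for w v
  proof
    fix u assume "u \<in> closed_segment w v"
    then obtain t where t: "0 \<le> t" "u = w + t *\<^sub>R (v - w)"
      by (auto simp: in_segment algebra_simps)
    then show "u \<in> garding_cone c"
      using le by (auto intro!: garding_cone_add[OF w] mult_nonneg_nonneg)
  qed
  have "connected_component (garding_cone c) w w'"
    if w: "w \<in> garding_cone c" "w' \<in> garding_cone c" for w w'
  proof -
    obtain v where v: "\<forall>i. w $ i \<le> v $ i" "\<forall>i. w' $ i \<le> v $ i" using * by blast
    have "connected_component (garding_cone c) w v"
      unfolding connected_component_def using seg[OF w(1) v(1)] connected_segment ends_in_segment by metis
    moreover have "connected_component (garding_cone c) w' v"
      unfolding connected_component_def using seg[OF w(2) v(2)] connected_segment ends_in_segment by metis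
    ultimately show ?thesis
      using connected_component_sym connected_component_trans by metis
  qed
  then show ?thesis
    unfolding connected_iff_connected_component by simp
qed

text \<open>
  Nonnegativity of the Rayleigh differences is inherited by derivatives: on the ray
  \<open>w + t e\<^sub>k\<close>, which stays inside the cone, the difference is a quadratic polynomial in \<open>t\<close> whose
  leading coefficient is the difference of the \<open>k\<close>-th derivative.
\<close>

lemma rayleigh_diff_dcoef_nonneg:
  assumes "\<And>i j w. i \<noteq> j \<Longrightarrow> w \<in> garding_cone c \<Longrightarrow> 0 \<le> rayleigh_diff c i j w"
    and "i \<noteq> j" "w \<in> garding_cone c"
  shows "0 \<le> rayleigh_diff (dcoef T c) i j w"
proof (cases "i \<in> T \<or> j \<in> T")
  case True
  then have "dcoef {i} (dcoef T c) = (\<lambda>U. 0) \<or> dcoef {j} (dcoef T c) = (\<lambda>U. 0)"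
    using dcoef_singleton_eq_0[of i T c] dcoef_singleton_eq_0[of j T c] by argo
  moreover have "dcoef {i, j} (dcoef T c) = (\<lambda>U. 0)"
    using True by (auto simp: dcoef_def fun_eq_iff)
  ultimately show ?thesis by (auto simp: rayleigh_diff_def)
next
  case False
  have "finite T" by simp
  then show ?thesis using False assms(3)
  proof (induction arbitrary: w)
    case empty
    then show ?case using assms by simp
  next
    case (insert k T)
    let ?f = "dcoef T c"
    have k: "dcoef {k} ?f = dcoef (insert k T) c"
      using insert by (subst dcoef_dcoef) auto
    have kS: "dcoef {k} (dcoef S ?f) = dcoef S (dcoef (insert k T) c)" if "S \<subseteq> {i, j}" for S
      using that insert by (auto simp: dcoef_def fun_eq_iff Un_ac)
    \<comment> \<open>Along the direction \<open>k\<close> the Rayleigh difference of \<open>?f\<close> is a quadratic \<open>p + q t + r t\<^sup>2\<close>,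
      and \<open>r\<close> is the Rayleigh difference of the \<open>k\<close>-th derivative of \<open>?f\<close>.\<close>
    define p where "p = mapoly (dcoef {i} ?f) w * mapoly (dcoef {j} ?f) w - mapoly ?f w * mapoly (dcoef {i, j} ?f) w"
    define r where "r = rayleigh_diff (dcoef (insert k T) c) i j w"
    define q where "q = mapoly (dcoef {i} ?f) w * mapoly (dcoef {j} (dcoef (insert k T) c)) w
       + mapoly (dcoef {j} ?f) w * mapoly (dcoef {i} (dcoef (insert k T) c)) w
       - mapoly ?f w * mapoly (dcoef {i, j} (dcoef (insert k T) c)) w
       - mapoly (dcoef {i, j} ?f) w * mapoly (dcoef (insert k T) c) w"
    have "rayleigh_diff ?f i j (w + t *\<^sub>R axis k 1) = p + q * t + r * t\<^sup>2" for t
      unfolding rayleigh_diff_def p_def q_def r_def mapoly_add_axis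
      by (simp add: kS k power2_eq_square algebra_simps)
    moreover have "0 \<le> rayleigh_diff ?f i j (w + t *\<^sub>R axis k 1)" if "0 \<le> t" for t
      using insert.IH insert.prems garding_cone_add_axis[OF insert.prems(2) that] by auto
    ultimately have nonneg: "0 \<le> p + q * t + r * t\<^sup>2" if "0 \<le> t" for t
      using that by simp
    have "0 \<le> r"
    proof (rule ccontr)
      assume "\<not> 0 \<le> r"
      then have r: "0 < - r" by simp
      \<comment> \<open>A point beyond which the negative leading term dominates.\<close>
      define t where "t = 1 + (\<bar>p\<bar> + \<bar>q\<bar>) / - r"
      have "0 \<le> (\<bar>p\<bar> + \<bar>q\<bar>) / - r"
        using r by (intro divide_nonneg_pos) auto
      then have t: "1 \<le> t" by (simp add: t_def)
      have "q * t \<le> \<bar>q\<bar> * t" "\<bar>p\<bar> * 1 \<le> \<bar>p\<bar> * t"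
        using t by (intro mult_right_mono mult_left_mono; simp)+
      then have "p + q * t \<le> (\<bar>p\<bar> + \<bar>q\<bar>) * t"
        by (simp add: distrib_right)
      also have "\<dots> < (- r * t) * t"
        using t r mult_neg_neg[of r r]
        by (intro mult_strict_right_mono) (auto simp: t_def field_simps)
      finally show False
        using nonneg[of t] t by (simp add: power2_eq_square)
    qed
    then show ?case by (simp add: r_def)
  qed
qed


text \<open>
  Cleared of denominators, this says that \<open>\<partial>\<^sub>i g / g\<close> decreases along nonnegative directions for
  every derivative \<open>g\<close> of the polynomial. A single step in direction \<open>j\<close> changes the cross product
  by \<open>t\<close> times the Rayleigh difference of \<open>g\<close>. The form without denominators is the one that
  survives passage to the closure of the cone.
\<close>

lemma garding_cone_ratio_antimono:
  assumes D: "\<And>i j w. i \<noteq> j \<Longrightarrow> w \<in> garding_cone c \<Longrightarrow> 0 \<le> rayleigh_diff c i j w"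
    and nz: "dcoef T c \<noteq> (\<lambda>U. 0)"
    and w: "w \<in> garding_cone c" and y: "\<And>k. 0 \<le> y $ k"
  shows "mapoly (dcoef T c) w * mapoly (dcoef {i} (dcoef T c)) (w + y)
    \<le> mapoly (dcoef {i} (dcoef T c)) w * mapoly (dcoef T c) (w + y)"
proof -
  let ?f = "dcoef T c"
  let ?r = "\<lambda>v. mapoly (dcoef {i} ?f) v / mapoly ?f v"
  have pos: "0 < mapoly ?f v" if "v \<in> garding_cone c" for v
    using that nz by (auto simp: garding_cone_def)
  have step: "?r (v + t *\<^sub>R axis j 1) \<le> ?r v" if v: "v \<in> garding_cone c" and t: "0 \<le> t" for v t j
  proof -
    have "0 \<le> mapoly (dcoef {i} ?f) v * mapoly (dcoef {j} ?f) v
        - mapoly ?f v * mapoly (dcoef {j} (dcoef {i} ?f)) v"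
    proof (cases "i = j")
      case True
      then show ?thesis by (simp add: dcoef_singleton_eq_0)
    next
      case False
      then show ?thesis
        using rayleigh_diff_dcoef_nonneg[of c i j v T, OF D False v]
        by (simp add: rayleigh_diff_def dcoef_pair insert_commute)
    qed
    then have "0 \<le> t * (mapoly (dcoef {i} ?f) v * mapoly (dcoef {j} ?f) v
        - mapoly ?f v * mapoly (dcoef {j} (dcoef {i} ?f)) v)"
      using t by simp
    then have "mapoly (dcoef {i} ?f) (v + t *\<^sub>R axis j 1) * mapoly ?f v
        \<le> mapoly (dcoef {i} ?f) v * mapoly ?f (v + t *\<^sub>R axis j 1)"
      unfolding mapoly_add_axis by (simp add: algebra_simps)
    then show ?thesis
      using pos[OF v] pos[OF garding_cone_add_axis[OF v t]] by (simp add: divide_simps mult.commute)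
  qed
  have "w + y \<in> garding_cone c \<and> ?r (w + y) \<le> ?r w"
  proof (rule orthant_direction_induct[where P = "\<lambda>v. v \<in> garding_cone c \<and> ?r v \<le> ?r w", OF y])
    show "w \<in> garding_cone c \<and> ?r w \<le> ?r w" using w by simp
  next
    fix v t k
    assume "v \<in> garding_cone c \<and> ?r v \<le> ?r w" and t: "(0::real) \<le> t"
    then show "v + t *\<^sub>R axis k 1 \<in> garding_cone c \<and> ?r (v + t *\<^sub>R axis k 1) \<le> ?r w"
      using order_trans[OF step[of v t k]] garding_cone_add_axis[of v c t k] by blast
  qed
  then show ?thesis
    using pos[OF w] pos[of "w + y"] by (simp add: divide_simps mult.commute)
qed

text \<open>
  A boundary point of the cone can only fail to lie in it because some derivative drops to
  zero. Take such a derivative \<open>\<partial>\<^sub>i g\<close> with \<open>g\<close> still positive: by the monotonicity of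
  \<open>\<partial>\<^sub>i g / g\<close> it would vanish at all larger points, in particular in the positive orthant.
\<close>

lemma garding_cone_relatively_closed:
  assumes c: "\<And>T. 0 \<le> c T"
    and D: "\<And>i j w. i \<noteq> j \<Longrightarrow> w \<in> garding_cone c \<Longrightarrow> 0 \<le> rayleigh_diff c i j w"
    and w: "w \<in> closure (garding_cone c)" "0 < mapoly c w"
  shows "w \<in> garding_cone c"
proof -
  have "dcoef T c \<noteq> (\<lambda>U. 0) \<longrightarrow> 0 < mapoly (dcoef T c) w" for T
  proof (induction T rule: finite_induct[OF finite])
    case 1
    then show ?case using w by simp
  next
    case (2 i T)
    let ?f = "dcoef T c"
    have i: "dcoef {i} ?f = dcoef (insert i T) c"
      using 2 by (subst dcoef_dcoef) auto
    show ?case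
    proof
      assume nz: "dcoef (insert i T) c \<noteq> (\<lambda>U. 0)"
      have nz': "?f \<noteq> (\<lambda>U. 0)"
      proof
        assume "?f = (\<lambda>U. 0)"
        with nz show False unfolding i[symmetric] by (simp only: dcoef_zero simp_thms)
      qed
      have pos: "0 < mapoly ?f w" using 2 nz' by blast
      \<comment> \<open>\<open>w + y\<close> is in the open orthant, where no nonzero derivative vanishes; the ratio bound,
        passed to the limit \<open>w\<close>, carries the positivity of the derivative there down to \<open>w\<close>.\<close>
      define y :: "real ^ 'a" where "y = (\<chi> k. \<bar>w $ k\<bar> + 1)"
      have "0 < w $ k + (\<bar>w $ k\<bar> + 1)" for k by linarith
      then have wy: "w + y \<in> pos_orthant"
        by (simp add: pos_orthant_def y_def)
      have "closed {v. mapoly ?f v * mapoly (dcoef {i} ?f) (v + y)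
          \<le> mapoly (dcoef {i} ?f) v * mapoly ?f (v + y)}"
        by (intro closed_Collect_le continuous_intros)
      moreover have "garding_cone c \<subseteq> {v. mapoly ?f v * mapoly (dcoef {i} ?f) (v + y)
          \<le> mapoly (dcoef {i} ?f) v * mapoly ?f (v + y)}"
        using garding_cone_ratio_antimono[OF D nz'] by (auto simp: y_def)
      ultimately have "mapoly ?f w * mapoly (dcoef {i} ?f) (w + y)
          \<le> mapoly (dcoef {i} ?f) w * mapoly ?f (w + y)"
        using closure_minimal[of "garding_cone c"] w(1) by (metis (no_types, lifting) mem_Collect_eq subset_iff)
      moreover have "0 < mapoly ?f w * mapoly (dcoef {i} ?f) (w + y)"
        unfolding i using nz
        by (intro mult_pos_pos mapoly_pos wy pos) (simp_all add: dcoef_def c)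
      ultimately have "0 < mapoly (dcoef {i} ?f) w * mapoly ?f (w + y)"
        by simp
      moreover have "0 < mapoly ?f (w + y)"
        using nz' by (intro mapoly_pos wy) (simp_all add: dcoef_def c)
      ultimately show "0 < mapoly (dcoef (insert i T) c) w"
        unfolding i by (simp add: zero_less_mult_iff)
    qed
  qed
  then show ?thesis by (simp add: garding_cone_def)
qed

lemma mem_closure_pos_orthant:
  assumes "y \<in> closure pos_orthant"
  shows "0 \<le> y $ i"
proof -
  have "closed {y :: real ^ 'a. 0 \<le> y $ i}"
    by (intro closed_Collect_le continuous_intros)
  moreover have "pos_orthant \<subseteq> {y :: real ^ 'a. 0 \<le> y $ i}"
    by (auto simp: pos_orthant_def less_imp_le)
  ultimately show ?thesis using closure_minimal assms by blast
qed

text \<open>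
  The cone is open, connected and relatively closed in \<open>{f > 0}\<close>, hence a connected component
  of it, and it absorbs the orthant by construction.
\<close>

theorem garding_mapoly:
  assumes c: "\<And>T. 0 \<le> c T" "c \<noteq> (\<lambda>T. 0)"
    and D: "\<And>i j w. i \<noteq> j \<Longrightarrow> w \<in> garding_cone c \<Longrightarrow> 0 \<le> rayleigh_diff c i j w"
  shows "garding (mapoly c)"
proof -
  let ?K = "garding_cone c" and ?P = "{w. 0 < mapoly c w}"
  have one: "(\<chi> i. 1) \<in> (pos_orthant :: (real ^ 'a) set)"
    by (simp add: pos_orthant_def)
  have K_ne: "?K \<noteq> {}"
    using one pos_orthant_subset_garding_cone[of c] c by blast
  have K_P: "?K \<subseteq> ?P"
    using c(2) by (auto simp: garding_cone_def dest!: spec[of _ "{}"])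
  have "?K \<in> components ?P"
    unfolding in_components_maximal
  proof (intro conjI allI impI)
    show "?K \<noteq> {}" "?K \<subseteq> ?P" "connected ?K"
      using K_ne K_P connected_garding_cone .
  next
    fix S assume S: "S \<noteq> {} \<and> ?K \<subseteq> S \<and> S \<subseteq> ?P \<and> connected S"
    have "S \<inter> closure ?K \<subseteq> ?K"
      using S garding_cone_relatively_closed[OF c(1) D] by blast
    then have "S \<subseteq> ?K \<union> - closure ?K" by blast
    moreover have "?K \<inter> - closure ?K \<inter> S = {}"
      using closure_subset by blast
    ultimately have "?K \<inter> S = {} \<or> - closure ?K \<inter> S = {}"
      using connectedD[of S ?K "- closure ?K"] S open_garding_cone by blast
    then show "S = ?K"
      using S K_ne \<open>S \<inter> closure ?K \<subseteq> ?K\<close> by blast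
  qed
  moreover have "{x + y | x y. x \<in> ?K \<and> y \<in> closure pos_orthant} \<subseteq> ?K"
    using garding_cone_add mem_closure_pos_orthant by blast
  moreover have "mapoly c \<noteq> (\<lambda>w. 0)"
    using mapoly_pos[OF c one] by (metis less_irrefl)
  moreover have "multi_affine (mapoly c)"
    unfolding multi_affine_def mapoly_def by blast
  ultimately show ?thesis
    unfolding garding_def by blast
qed

section \<open>The Rayleigh property of the reversed polynomial\<close>

definition recip :: "real ^ 'n::finite \<Rightarrow> real ^ 'n"
  where "recip w = (\<chi> i. inverse (w $ i))"

lemma mapoly_reverse:
  assumes "w \<in> pos_orthant"
  shows "mapoly (\<lambda>T. c (- T)) w = mono_prod UNIV w * mapoly c (recip w)"
proof -
  have nz: "w $ i \<noteq> 0" for i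
    using assms by (simp add: pos_orthant_def less_imp_neq[symmetric])
  have complement: "mono_prod T w = mono_prod UNIV w * mono_prod (- T) (recip w)" for T
  proof -
    have "mono_prod UNIV w = mono_prod T w * mono_prod (- T) w"
      unfolding mono_prod_def by (subst prod.union_disjoint[symmetric]) auto
    moreover have "mono_prod (- T) w * mono_prod (- T) (recip w) = 1"
      unfolding mono_prod_def recip_def using nz by (simp flip: prod.distrib)
    ultimately show ?thesis by simp
  qed
  have "mapoly (\<lambda>T. c (- T)) w
      = (\<Sum>T\<in>UNIV. c (- T) * (mono_prod UNIV w * mono_prod (- T) (recip w)))"
    unfolding mapoly_def using complement by (intro sum.cong refl arg_cong2[of _ _ _ _ "(*)"])
  also have "\<dots> = (\<Sum>T\<in>UNIV. c T * (mono_prod UNIV w * mono_prod T (recip w)))"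
    by (rule sum.reindex_bij_witness[of _ uminus uminus]) auto
  finally show ?thesis
    by (simp add: mapoly_def sum_distrib_left mult_ac)
qed

text \<open>
  Doubling one coordinate halves its reciprocal; since the polynomials are affine in each
  variable, this finite step determines their derivatives at \<open>w\<close>, and no derivative of the map
  \<open>recip\<close> has to be taken.
\<close>

lemma recip_double:
  assumes "w \<in> pos_orthant"
  shows "w + (w $ i) *\<^sub>R axis i 1 \<in> pos_orthant"
    and "recip (w + (w $ i) *\<^sub>R axis i 1) = recip w + (- (recip w $ i / 2)) *\<^sub>R axis i 1"
    and "mono_prod UNIV (w + (w $ i) *\<^sub>R axis i 1) = 2 * mono_prod UNIV w"
proof -
  show "w + (w $ i) *\<^sub>R axis i 1 \<in> pos_orthant"
    using assms by (auto simp: pos_orthant_def axis_def)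
  show "recip (w + (w $ i) *\<^sub>R axis i 1) = recip w + (- (recip w $ i / 2)) *\<^sub>R axis i 1"
    by (auto simp: vec_eq_iff recip_def axis_def divide_simps)
  show "mono_prod UNIV (w + (w $ i) *\<^sub>R axis i 1) = 2 * mono_prod UNIV w"
    using prod.remove[of UNIV i "\<lambda>e. w $ e"] by (simp add: mono_prod_add_axis) (simp add: mono_prod_def)
qed

lemma mapoly_reverse_deriv:
  assumes "w \<in> pos_orthant"
  shows "w $ i * mapoly (dcoef {i} (\<lambda>T. c (- T))) w
    = mono_prod UNIV w * (mapoly c (recip w) - recip w $ i * mapoly (dcoef {i} c) (recip w))"
proof -
  have double: "mapoly (\<lambda>T. c (- T)) (w + (w $ i) *\<^sub>R axis i 1) = 2 * mono_prod UNIV w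
      * (mapoly c (recip w) - recip w $ i / 2 * mapoly (dcoef {i} c) (recip w))"
    unfolding mapoly_reverse[OF recip_double(1)[OF assms]] recip_double(2,3)[OF assms]
    unfolding mapoly_add_axis by simp
  have "w $ i * mapoly (dcoef {i} (\<lambda>T. c (- T))) w
      = mapoly (\<lambda>T. c (- T)) (w + (w $ i) *\<^sub>R axis i 1) - mapoly (\<lambda>T. c (- T)) w"
    by (simp add: mapoly_add_axis)
  also have "\<dots> = 2 * mono_prod UNIV w
      * (mapoly c (recip w) - recip w $ i / 2 * mapoly (dcoef {i} c) (recip w))
      - mono_prod UNIV w * mapoly c (recip w)"
    unfolding mapoly_reverse[OF assms] double ..
  finally show ?thesis by (simp add: algebra_simps)
qed

lemma mapoly_reverse_deriv2:
  assumes w: "w \<in> pos_orthant" and ij: "i \<noteq> j"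
  shows "w $ i * w $ j * mapoly (dcoef {i, j} (\<lambda>T. c (- T))) w
    = mono_prod UNIV w * (mapoly c (recip w) - recip w $ i * mapoly (dcoef {i} c) (recip w)
        - recip w $ j * mapoly (dcoef {j} c) (recip w)
        + recip w $ i * recip w $ j * mapoly (dcoef {i, j} c) (recip w))"
proof -
  let ?r = "\<lambda>T. c (- T)" and ?v = "w + (w $ i) *\<^sub>R axis i 1"
  have "axis i 1 $ j = (0 :: real)"
    using ij by (simp add: axis_def)
  then have double: "w $ j * mapoly (dcoef {j} ?r) ?v = 2 * mono_prod UNIV w
        * (mapoly c (recip w) - recip w $ i / 2 * mapoly (dcoef {i} c) (recip w)
          - recip w $ j * (mapoly (dcoef {j} c) (recip w)
              - recip w $ i / 2 * mapoly (dcoef {i, j} c) (recip w)))"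
    using mapoly_reverse_deriv[OF recip_double(1)[OF w], of i j c] ij
    unfolding recip_double(2,3)[OF w] mapoly_add_axis[of _ "recip w"]
    by (simp add: dcoef_pair)
  have "w $ i * w $ j * mapoly (dcoef {i, j} ?r) w
      = w $ j * mapoly (dcoef {j} ?r) ?v - w $ j * mapoly (dcoef {j} ?r) w"
    using ij by (simp add: mapoly_add_axis dcoef_pair algebra_simps)
  also have "\<dots> = 2 * mono_prod UNIV w
        * (mapoly c (recip w) - recip w $ i / 2 * mapoly (dcoef {i} c) (recip w)
          - recip w $ j * (mapoly (dcoef {j} c) (recip w)
              - recip w $ i / 2 * mapoly (dcoef {i, j} c) (recip w)))
      - mono_prod UNIV w * (mapoly c (recip w) - recip w $ j * mapoly (dcoef {j} c) (recip w))"
    unfolding mapoly_reverse_deriv[OF w] double ..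
  finally show ?thesis by (simp add: algebra_simps)
qed

text \<open>
  Reversal multiplies the Rayleigh difference by a positive monomial and evaluates it at the
  reciprocal point.
\<close>

lemma rayleigh_reverse:
  assumes c: "\<And>T. 0 \<le> c T" and "rayleigh (mapoly c)"
  shows "rayleigh (mapoly (\<lambda>T. c (- T)))"
  unfolding rayleigh_mapoly_iff[of "\<lambda>T. c (- T)", OF c]
proof (intro allI impI ballI)
  fix i j :: 'a and w :: "real ^ 'a"
  assume ij: "i \<noteq> j" and w: "w \<in> pos_orthant"
  let ?r = "\<lambda>T. c (- T)"
  have r: "recip w \<in> pos_orthant"
    using w by (simp add: pos_orthant_def recip_def)
  then have *: "0 \<le> rayleigh_diff c i j (recip w)"
    using assms ij by (simp add: rayleigh_mapoly_iff)
  have "w $ i * w $ j * rayleigh_diff ?r i j w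
      = (w $ i * mapoly (dcoef {i} ?r) w) * (w $ j * mapoly (dcoef {j} ?r) w)
        - mapoly ?r w * (w $ i * w $ j * mapoly (dcoef {i, j} ?r) w)"
    by (simp add: rayleigh_diff_def algebra_simps)
  also have "\<dots> = (mono_prod UNIV w)\<^sup>2 * (recip w $ i * recip w $ j) * rayleigh_diff c i j (recip w)"
    unfolding mapoly_reverse_deriv[OF w] mapoly_reverse_deriv2[OF w ij] mapoly_reverse[OF w]
    by (simp add: rayleigh_diff_def power2_eq_square algebra_simps)
  also have "\<dots> \<ge> 0"
    using r * by (intro mult_nonneg_nonneg) (auto simp: pos_orthant_def less_imp_le)
  finally have "0 \<le> w $ i * w $ j * rayleigh_diff ?r i j w" .
  moreover have "0 < w $ i * w $ j"
    using w by (simp add: pos_orthant_def)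
  ultimately show "0 \<le> rayleigh_diff ?r i j w"
    by (simp add: zero_le_mult_iff)
qed

section \<open>The inequality behind the cospanning polynomial\<close>

text \<open>
  This is the Rayleigh difference of the cospanning polynomial of the Fano matroid at two
  points of a line whose third point has weight \<open>x\<close>; the four points \<open>a, b, c, d\<close> off the line enter
  through \<open>p = a + d\<close>, \<open>U = a d\<close>, \<open>q = b + c\<close> and \<open>V = b c\<close> only. The pairs \<open>{a, d}\<close> and \<open>{b, c}\<close> are cut out
  by the other two lines through the third point.

  The signs of \<open>U\<close>, \<open>V\<close> and \<open>x\<close> decide which argument applies. The recurring quantities are
  \<open>G = U q + V p + U V\<close>, which is the sum of the third and fourth elementary symmetric polynomials
  of \<open>a, b, c, d\<close>; the derivatives \<open>\<alpha> = (1 + x) (1 + p + U) - 1\<close> and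
  \<open>\<beta> = (1 + x) (1 + q + V) - 1\<close> of order four; and the coefficient
  \<open>D = (p + U) (q + V) (1 + x) + x (p + U + q + V)\<close> of the product of the two chosen variables. They
  satisfy \<open>\<alpha> \<beta> = x\<^sup>2 + (1 + x) D\<close>.
\<close>

definition cospan_disc :: "real \<Rightarrow> real \<Rightarrow> real \<Rightarrow> real \<Rightarrow> real \<Rightarrow> real"
  where "cospan_disc x p q U V =
    (1 + x) * (U * q + V * p + U * V)\<^sup>2 + 2 * x * (U + V) * (U * q + V * p + U * V)
      + x\<^sup>2 * ((1 + p + U) * V\<^sup>2 + (1 + q + V) * U\<^sup>2 - 2 * U * V)"

lemma cospan_disc_commute: "cospan_disc x p q U V = cospan_disc x q p V U"
  by (simp add: cospan_disc_def algebra_simps)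

text \<open>
  Completing a square; it serves when \<open>U\<close> and \<open>V\<close> are not both positive.
\<close>

lemma cospan_disc_times:
  fixes x p q U V :: real
  defines "\<alpha> \<equiv> (1 + x) * (1 + p + U) - 1" and "\<beta> \<equiv> (1 + x) * (1 + q + V) - 1"
  shows "(1 + x) * cospan_disc x p q U V = (\<alpha> * V + \<beta> * U - (1 + x) * (U * V))\<^sup>2
    + x\<^sup>2 * (\<alpha> * V\<^sup>2 + \<beta> * U\<^sup>2 - 2 * (2 + x) * (U * V))"
  unfolding cospan_disc_def \<alpha>_def \<beta>_def by (simp add: power2_eq_square algebra_simps)

lemma cospan_disc_nonneg_opposite:
  assumes "0 < 1 + x" "0 \<le> (1 + x) * (1 + p + U) - 1" "0 \<le> (1 + x) * (1 + q + V) - 1" "U * V \<le> 0"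
  shows "0 \<le> cospan_disc x p q U V"
proof -
  have "2 * (2 + x) * (U * V) \<le> 0"
    using assms(1,4) by (intro mult_nonneg_nonpos[of "2 * (2 + x)"]) auto
  moreover have "0 \<le> ((1 + x) * (1 + p + U) - 1) * V\<^sup>2" "0 \<le> ((1 + x) * (1 + q + V) - 1) * U\<^sup>2"
    using assms(2,3) by (intro mult_nonneg_nonneg; simp)+
  ultimately have "0 \<le> ((1 + x) * (1 + p + U) - 1) * V\<^sup>2 + ((1 + x) * (1 + q + V) - 1) * U\<^sup>2
      - 2 * (2 + x) * (U * V)"
    by linarith
  then have "0 \<le> (1 + x) * cospan_disc x p q U V"
    unfolding cospan_disc_times by (intro add_nonneg_nonneg mult_nonneg_nonneg zero_le_power2)
  then show ?thesis using assms(1) by (simp add: zero_le_mult_iff)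
qed

text \<open>
  Here \<open>\<alpha> V + \<beta> U\<close> is negative, so that subtracting \<open>(1 + x) U V\<close> only increases its square,
  and both \<open>(\<alpha> V + \<beta> U)\<^sup>2\<close> and \<open>\<alpha> V\<^sup>2 + \<beta> U\<^sup>2\<close> are bounded below by the inequality between the
  arithmetic and geometric means together with \<open>\<alpha> \<beta> \<ge> x\<^sup>2\<close>.
\<close>

lemma cospan_disc_nonneg_negative:
  assumes X: "0 < 1 + x" and \<alpha>: "0 \<le> (1 + x) * (1 + p + U) - 1" and \<beta>: "0 \<le> (1 + x) * (1 + q + V) - 1"
    and \<alpha>\<beta>: "x\<^sup>2 \<le> ((1 + x) * (1 + p + U) - 1) * ((1 + x) * (1 + q + V) - 1)"
    and neg: "U < 0" "V < 0"
  shows "0 \<le> cospan_disc x p q U V"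
proof -
  define \<alpha>' \<beta>' where ab: "\<alpha>' = (1 + x) * (1 + p + U) - 1" "\<beta>' = (1 + x) * (1 + q + V) - 1"
  define m where "m = U * V"
  define N where "N = \<alpha>' * V + \<beta>' * U"
  have m: "0 < m" using neg by (simp add: m_def mult_neg_neg)
  have nn: "0 \<le> \<alpha>'" "0 \<le> \<beta>'" "x\<^sup>2 \<le> \<alpha>' * \<beta>'" using \<alpha> \<beta> \<alpha>\<beta> by (simp_all add: ab)
  have N: "N \<le> 0"
    unfolding N_def using nn neg by (simp add: add_nonpos_nonpos mult_nonneg_nonpos)
  have N2: "4 * x\<^sup>2 * m \<le> N\<^sup>2"
  proof -
    have "N\<^sup>2 = (\<alpha>' * V - \<beta>' * U)\<^sup>2 + 4 * (\<alpha>' * \<beta>') * m"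
      by (simp add: N_def m_def power2_eq_square algebra_simps)
    moreover have "x\<^sup>2 * m \<le> \<alpha>' * \<beta>' * m" using nn m by simp
    moreover have "0 \<le> (\<alpha>' * V - \<beta>' * U)\<^sup>2" by simp
    ultimately show ?thesis by linarith
  qed
  have Q: "2 * \<bar>x\<bar> * m \<le> \<alpha>' * V\<^sup>2 + \<beta>' * U\<^sup>2"
  proof (rule power2_le_imp_le)
    have "(2 * \<bar>x\<bar> * m)\<^sup>2 = 4 * x\<^sup>2 * m\<^sup>2" by (simp add: power_mult_distrib)
    also have "\<dots> \<le> 4 * (\<alpha>' * \<beta>') * m\<^sup>2" using nn by (simp add: mult_right_mono)
    also have "\<dots> \<le> (\<alpha>' * V\<^sup>2 - \<beta>' * U\<^sup>2)\<^sup>2 + 4 * (\<alpha>' * \<beta>') * m\<^sup>2" by simp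
    also have "\<dots> = (\<alpha>' * V\<^sup>2 + \<beta>' * U\<^sup>2)\<^sup>2" by (simp add: m_def power2_eq_square algebra_simps)
    finally show "(2 * \<bar>x\<bar> * m)\<^sup>2 \<le> (\<alpha>' * V\<^sup>2 + \<beta>' * U\<^sup>2)\<^sup>2" .
    show "0 \<le> \<alpha>' * V\<^sup>2 + \<beta>' * U\<^sup>2" using nn by simp
  qed
  have "4 * x\<^sup>2 * m \<le> (N - (1 + x) * m)\<^sup>2"
  proof -
    have "0 \<le> - 2 * N * ((1 + x) * m)" using N X m by (simp add: mult_nonpos_nonneg)
    moreover have "(N - (1 + x) * m)\<^sup>2 = N\<^sup>2 + - 2 * N * ((1 + x) * m) + ((1 + x) * m)\<^sup>2"
      by (simp add: power2_eq_square algebra_simps)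
    moreover have "0 \<le> ((1 + x) * m)\<^sup>2" by simp
    ultimately show ?thesis using N2 by linarith
  qed
  moreover have "x\<^sup>2 * (2 * \<bar>x\<bar> * m) \<le> x\<^sup>2 * (\<alpha>' * V\<^sup>2 + \<beta>' * U\<^sup>2)"
    using Q by (intro mult_left_mono) simp_all
  moreover have "x\<^sup>2 * (2 * x * m) \<le> x\<^sup>2 * (2 * \<bar>x\<bar> * m)"
    using m by (intro mult_left_mono mult_right_mono) simp_all
  ultimately have "0 \<le> (1 + x) * cospan_disc x p q U V"
    unfolding cospan_disc_times ab[symmetric] m_def[symmetric] N_def[symmetric]
    by (simp add: algebra_simps)
  then show ?thesis using X by (simp add: zero_le_mult_iff)
qed

text \<open>
  This disposes of the coefficient of \<open>x\<^sup>2\<close> in the polynomial.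
\<close>

lemma weighted_square_nonneg:
  fixes P Q U V :: real
  assumes "0 < P" "1 \<le> P * Q"
  shows "0 \<le> P * V\<^sup>2 + Q * U\<^sup>2 - 2 * U * V"
proof -
  have "P * (P * V\<^sup>2 + Q * U\<^sup>2 - 2 * U * V) = (P * V - U)\<^sup>2 + (P * Q - 1) * U\<^sup>2"
    by (simp add: power2_eq_square algebra_simps)
  also have "\<dots> \<ge> 0" using assms by simp
  finally show ?thesis using assms(1) by (simp add: zero_le_mult_iff)
qed

text \<open>
  Divided by \<open>x\<^sup>2\<close>, the polynomial is the quadratic \<open>J\<^sup>2 + G J - U V (4 + p + q)\<close> in a quantity \<open>J\<close>
  that is affine in \<open>1 / x\<close>. The value \<open>J\<^sub>0\<close> is the one that \<open>J\<close> takes at the zero of \<open>D\<close> as a function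
  of \<open>x\<close>. There the quadratic is nonnegative, by an identity that presents it as a square plus
  \<open>(p\<^sup>2 - 4 U) ((1 + p + U) (1 + q + V) - 1)\<close> times a square, up to positive factors; this is where it
  matters that \<open>p\<close> and \<open>U\<close> are the sum and the product of two real numbers. The last hypothesis says
  that passing from \<open>J\<^sub>0\<close> to \<open>J\<close> does not decrease the quadratic.
\<close>

lemma cospan_disc_root_factor:
  fixes x p q U V :: real
  defines "G \<equiv> U * q + V * p + U * V"
  defines "J \<equiv> - ((1 + x) * G + x * (U + V)) / x" and "J\<^sub>0 \<equiv> U * q / (p + U) + V * p / (q + V)"
  assumes x: "x \<noteq> 0" and p: "p \<noteq> 0" "p + U \<noteq> 0" "q + V \<noteq> 0"
    and P1: "0 < 1 + p + U" and disc: "4 * U \<le> p\<^sup>2"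
    and PQ: "1 \<le> (1 + p + U) * (1 + q + V)"
    and side: "0 \<le> (J - J\<^sub>0) * (J + J\<^sub>0 + G)"
  shows "0 \<le> cospan_disc x p q U V"
proof -
  let ?E = "J\<^sub>0\<^sup>2 + G * J\<^sub>0 - U * V * (4 + p + q)"
  define p1 q1 where p1: "p1 = p + U" and q1: "q1 = q + V"
  define a b where "a = U * q * q1" and "b = V * p * p1"
  have "p1 \<noteq> 0" "q1 \<noteq> 0" using p by (simp_all add: p1 q1)
  then have J0: "J\<^sub>0 * (p1 * q1) = a + b"
    unfolding J\<^sub>0_def a_def b_def p1[symmetric] q1[symmetric] by (simp add: distrib_right)
  have "?E * (p1 * q1)\<^sup>2 = (J\<^sub>0 * (p1 * q1))\<^sup>2 + G * (p1 * q1) * (J\<^sub>0 * (p1 * q1))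
      - U * V * (4 + p + q) * (p1 * q1)\<^sup>2"
    by (simp add: power2_eq_square algebra_simps)
  then have "(1 + p1) * p\<^sup>2 * (?E * (p1 * q1)\<^sup>2)
      = ((1 + p1) * p * a - (p + 2 * U) * b)\<^sup>2 + b\<^sup>2 * (p\<^sup>2 - 4 * U) * ((1 + p1) * (1 + q1) - 1)"
    unfolding J0 unfolding a_def b_def G_def p1 q1 by (simp add: power2_eq_square algebra_simps)
  also have "\<dots> \<ge> 0"
    using disc PQ by (intro add_nonneg_nonneg mult_nonneg_nonneg) (simp_all add: p1 q1 add.assoc)
  finally have "0 \<le> ((1 + p1) * p\<^sup>2 * (p1 * q1)\<^sup>2) * ?E" by (simp add: mult_ac)
  moreover have "0 < (1 + p1) * p\<^sup>2 * (p1 * q1)\<^sup>2"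
    using p P1 by (simp add: p1 q1 add.assoc)
  ultimately have E: "0 \<le> ?E" by (simp only: zero_le_mult_iff) linarith
  have "J * x = - ((1 + x) * G + x * (U + V))" using x by (simp add: J_def)
  then have "cospan_disc x p q U V = (J * x)\<^sup>2 + x * G * (J * x) - x\<^sup>2 * (U * V * (4 + p + q))"
    by (simp only:) (simp add: cospan_disc_def G_def power2_eq_square algebra_simps)
  also have "\<dots> = x\<^sup>2 * (?E + (J - J\<^sub>0) * (J + J\<^sub>0 + G))"
    by (simp add: power2_eq_square algebra_simps)
  also have "\<dots> \<ge> 0" using E side by simp
  finally show ?thesis .
qed

text \<open>
  The displacement \<open>J - J\<^sub>0\<close> is a multiple of \<open>D G\<close>, so its sign is known as soon as \<open>D \<ge> 0\<close>.
\<close>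

lemma cospan_disc_root_gap:
  fixes x p q U V :: real
  defines "G \<equiv> U * q + V * p + U * V"
  assumes "x \<noteq> 0" "p + U \<noteq> 0" "q + V \<noteq> 0"
  shows "- ((1 + x) * G + x * (U + V)) / x - (U * q / (p + U) + V * p / (q + V))
    = - (((p + U) * (q + V) * (1 + x) + x * (p + U + (q + V))) * G) / (x * ((p + U) * (q + V)))"
  using assms(2-) unfolding G_def by (simp add: divide_simps) (simp add: algebra_simps)

text \<open>
  For \<open>x \<ge> 0\<close> every summand of the polynomial is nonnegative. For \<open>x < 0\<close> both \<open>J - J\<^sub>0\<close> and
  \<open>J + J\<^sub>0 + G\<close> are nonnegative.
\<close>

lemma cospan_disc_nonneg_positive:
  assumes pos: "0 < p" "0 < q" "0 < U" "0 < V" and disc: "4 * U \<le> p\<^sup>2" and X: "0 < 1 + x"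
    and D: "0 \<le> (p + U) * (q + V) * (1 + x) + x * (p + U + (q + V))"
  shows "0 \<le> cospan_disc x p q U V"
proof (cases "0 \<le> x")
  case True
  have "1 * 1 \<le> (1 + p + U) * (1 + q + V)"
    using pos by (intro mult_mono) auto
  then have "0 \<le> (1 + p + U) * V\<^sup>2 + (1 + q + V) * U\<^sup>2 - 2 * U * V"
    using pos by (intro weighted_square_nonneg) auto
  then show ?thesis
    unfolding cospan_disc_def using True pos by simp
next
  let ?G = "U * q + V * p + U * V"
  let ?J = "- ((1 + x) * ?G + x * (U + V)) / x" and ?K = "U * q / (p + U) + V * p / (q + V)"
  case False
  have G: "0 \<le> ?G" and J0: "0 \<le> ?K" using pos by simp_all
  have gap: "0 \<le> ?J - ?K"
  proof -
    have "x * ((p + U) * (q + V)) < 0"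
      using False pos by (intro mult_neg_pos mult_pos_pos) auto
    moreover have "0 \<le> ((p + U) * (q + V) * (1 + x) + x * (p + U + (q + V))) * ?G"
      using D G by (rule mult_nonneg_nonneg)
    moreover have "?J - ?K
        = - (((p + U) * (q + V) * (1 + x) + x * (p + U + (q + V))) * ?G) / (x * ((p + U) * (q + V)))"
      by (rule cospan_disc_root_gap) (use False pos in auto)
    ultimately show ?thesis
      by (simp only:) (intro divide_nonpos_neg; linarith)
  qed
  show ?thesis
  proof (rule cospan_disc_root_factor)
    have "1 * 1 \<le> (1 + p + U) * (1 + q + V)"
      using pos by (intro mult_mono) auto
    then show "1 \<le> (1 + p + U) * (1 + q + V)" by simp
    show "0 \<le> (?J - ?K) * (?J + ?K + ?G)"
      using gap J0 G by (intro mult_nonneg_nonneg) linarith+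
  qed (use False pos disc in auto)
qed

text \<open>
  For \<open>G \<ge> 0\<close> every summand of the polynomial is nonnegative. For \<open>G < 0\<close> both \<open>J - J\<^sub>0\<close> and
  \<open>J + J\<^sub>0 + G\<close> are nonpositive. In both cases \<open>D \<ge> 0\<close> forces
  \<open>(1 + p + U) (1 + q + V) > 1\<close>.
\<close>

lemma cospan_disc_nonneg_mixed:
  assumes sgn: "p < 0" "p + U < 0" "0 < 1 + p + U" "0 < q" "0 < U" "0 < V"
    and disc: "4 * U \<le> p\<^sup>2" and x: "0 < x"
    and D: "0 \<le> (p + U) * (q + V) * (1 + x) + x * (p + U + (q + V))"
  shows "0 \<le> cospan_disc x p q U V"
proof -
  let ?G = "U * q + V * p + U * V"
  let ?J = "- ((1 + x) * ?G + x * (U + V)) / x" and ?K = "U * q / (p + U) + V * p / (q + V)"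
  have "(p + U) * (q + V) < 0" using sgn by (intro mult_neg_pos) auto
  then have "0 < x * ((1 + p + U) * (1 + q + V) - 1)"
    using D by (simp add: algebra_simps)
  then have PQ: "1 < (1 + p + U) * (1 + q + V)"
    using x by (simp add: zero_less_mult_iff)
  show ?thesis
  proof (cases "0 \<le> ?G")
    case True
    have "0 \<le> (1 + p + U) * V\<^sup>2 + (1 + q + V) * U\<^sup>2 - 2 * U * V"
      using sgn PQ by (intro weighted_square_nonneg) auto
    then show ?thesis
      unfolding cospan_disc_def using True x sgn by simp
  next
    case False
    have "U * q / (p + U) \<le> 0" "V * p / (q + V) \<le> 0"
      using sgn by (auto simp: divide_nonneg_neg divide_nonpos_pos mult_nonneg_nonpos)
    then have J0: "?K \<le> 0" by linarith
    have gap: "?J - ?K \<le> 0"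
    proof -
      have "x * ((p + U) * (q + V)) < 0"
        using x \<open>(p + U) * (q + V) < 0\<close> by (rule mult_pos_neg)
      moreover have "((p + U) * (q + V) * (1 + x) + x * (p + U + (q + V))) * ?G \<le> 0"
        using D False by (intro mult_nonneg_nonpos) auto
      moreover have "?J - ?K
          = - (((p + U) * (q + V) * (1 + x) + x * (p + U + (q + V))) * ?G) / (x * ((p + U) * (q + V)))"
        by (rule cospan_disc_root_gap) (use sgn x in auto)
      ultimately show ?thesis
        by (simp only:) (intro divide_nonneg_neg; linarith)
    qed
    show ?thesis
    proof (rule cospan_disc_root_factor)
      show "0 \<le> (?J - ?K) * (?J + ?K + ?G)"
        using gap J0 False by (intro mult_nonpos_nonpos) linarith+
    qed (use sgn x disc PQ in auto)
  qed
qed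

text \<open>
  The hypotheses are values of derivatives that are positive on the cone of the cospanning
  polynomial. If \<open>U\<close> and \<open>V\<close> are both positive, each of the pairs \<open>a, d\<close> and \<open>b, c\<close> has a
  common sign: two negative pairs are excluded, and one negative pair is the mixed case.
\<close>

lemma cospanning_rayleigh_inequality:
  fixes x a b c d :: real
  assumes X: "0 < 1 + x" and v: "0 < 1 + a" "0 < 1 + b" "0 < 1 + c" "0 < 1 + d"
    and \<alpha>: "1 \<le> (1 + x) * (1 + (a + d) + a * d)" and \<beta>: "1 \<le> (1 + x) * (1 + (b + c) + b * c)"
    and D: "0 \<le> (a + d + a * d) * (b + c + b * c) * (1 + x) + x * (a + d + a * d + (b + c + b * c))"
  shows "0 \<le> cospan_disc x (a + d) (b + c) (a * d) (b * c)"
proof -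
  define p1 q1 where pq: "p1 = a + d + a * d" "q1 = b + c + b * c"
  have disc: "4 * (s * t) \<le> (s + t)\<^sup>2" for s t :: real
    using sum_squares_ge_zero[of "s - t" 0] by (simp add: power2_eq_square algebra_simps)
  have less1: "0 < 1 + s + t + s * t" "s + t + s * t < 0" if "0 < 1 + s" "0 < 1 + t" "s < 0" "t < 0" for s t :: real
  proof -
    have "0 < (1 + s) * (1 + t)" using that by simp
    then show "0 < 1 + s + t + s * t" by (simp add: algebra_simps)
    have "t * (1 + s) < 0" using that by (intro mult_neg_pos)
    then show "s + t + s * t < 0" using that by (simp add: algebra_simps)
  qed
  consider "a * d * (b * c) \<le> 0" | "a * d < 0" "b * c < 0" | "0 < a * d" "0 < b * c"
    by (metis linorder_less_linear not_less zero_less_mult_iff)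
  then show ?thesis
  proof cases
    case 1
    then show ?thesis using \<alpha> \<beta> by (intro cospan_disc_nonneg_opposite X) linarith+
  next
    case 2
    have "((1 + x) * (1 + (a + d) + a * d) - 1) * ((1 + x) * (1 + (b + c) + b * c) - 1)
      = x\<^sup>2 + (1 + x) * (p1 * q1 * (1 + x) + x * (p1 + q1))"
      unfolding pq by (simp add: power2_eq_square algebra_simps)
    moreover have "0 \<le> (1 + x) * (p1 * q1 * (1 + x) + x * (p1 + q1))"
      using X D unfolding pq by (intro mult_nonneg_nonneg) linarith+
    ultimately have "x\<^sup>2 \<le> ((1 + x) * (1 + (a + d) + a * d) - 1) * ((1 + x) * (1 + (b + c) + b * c) - 1)"
      by simp
    then show ?thesis
      using 2 \<alpha> \<beta> by (intro cospan_disc_nonneg_negative X) linarith+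
  next
    case 3
    have adj: "1 \<le> (1 + x) * (1 + p1)" "1 \<le> (1 + x) * (1 + q1)" "0 \<le> p1 * q1 * (1 + x) + x * (p1 + q1)"
      using \<alpha> \<beta> D by (simp_all add: pq add.assoc)
    \<comment> \<open>A negative factor \<open>1 + t < 1\<close> has to be compensated by \<open>1 + x > 1\<close>.\<close>
    have xpos: "0 < x" if "t < 0" "1 \<le> (1 + x) * (1 + t)" for t
    proof (rule ccontr)
      assume "\<not> 0 < x"
      have "0 < (1 + x) * (1 + t)" using that(2) by linarith
      then have "0 < 1 + t" using X by (simp add: zero_less_mult_iff)
      then have "(1 + x) * (1 + t) \<le> 1 * (1 + t)"
        using \<open>\<not> 0 < x\<close> by (intro mult_right_mono) auto
      then show False using that by simp
    qed
    \<comment> \<open>With \<open>p1\<close> and \<open>q1\<close> both negative, \<open>D\<close> and \<open>\<alpha>\<close> contradict each other.\<close>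
    have not_both: False if neg: "p1 < 0" "q1 < 0"
    proof -
      have "0 \<le> (1 + x) * p1 + x" using adj(1) by (simp add: algebra_simps)
      then have "0 \<le> (- q1) * ((1 + x) * p1 + x)" using neg by (intro mult_nonneg_nonneg) auto
      moreover have "x * p1 < 0" using xpos[OF neg(1) adj(1)] neg(1) by (rule mult_pos_neg)
      ultimately show False using adj(3) by (simp add: algebra_simps)
    qed
    consider "0 < a" "0 < d" "0 < b" "0 < c" | "a < 0" "d < 0" "0 < b" "0 < c"
      | "0 < a" "0 < d" "b < 0" "c < 0" | "a < 0" "d < 0" "b < 0" "c < 0"
      using 3 by (auto simp: zero_less_mult_iff)
    then show ?thesis
    proof cases
      case 1
      then show ?thesis
        using 3 D disc by (intro cospan_disc_nonneg_positive X) (linarith | assumption)+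
    next
      case 2
      have "p1 < 0" "0 < 1 + p1" using less1[of a d] v 2 by (auto simp: pq)
      then show ?thesis
        using 3 2 D disc xpos[OF _ adj(1)] unfolding pq
        by (intro cospan_disc_nonneg_mixed) (linarith | assumption)+
    next
      case neg: 3
      have "q1 < 0" "0 < 1 + q1" using less1[of b c] v neg by (auto simp: pq)
      moreover have "0 \<le> (b + c + b * c) * (a + d + a * d) * (1 + x) + x * (b + c + b * c + (a + d + a * d))"
        using D by (simp add: mult.commute add.commute)
      ultimately show ?thesis
        unfolding cospan_disc_commute[of x "a + d"]
        using 3 neg disc xpos[OF _ adj(2)] unfolding pq
        by (intro cospan_disc_nonneg_mixed) (linarith | assumption)+
    next
      case 4
      then show ?thesis
        using v less1(2)[of a d] less1(2)[of b c] not_both unfolding pq by blast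
    qed
  qed
qed

section \<open>Labellings of the Fano plane\<close>

text \<open>
  In all expansions below, \<open>i\<close> and \<open>j\<close> are the chosen points, \<open>k\<close> is the third point of their
  line, and \<open>a, b, c, d\<close> are the points off this line.
\<close>

definition fano_labelled :: "7 \<Rightarrow> 7 \<Rightarrow> 7 \<Rightarrow> 7 \<Rightarrow> 7 \<Rightarrow> 7 \<Rightarrow> 7 \<Rightarrow> bool"
  where "fano_labelled i j k a b c d \<longleftrightarrow> distinct [i, j, k, a, b, c, d] \<and>
    fano_lines = {{i, j, k}, {i, a, b}, {i, c, d}, {j, a, c}, {j, b, d}, {k, a, d}, {k, b, c}}"

lemma fano_labelled_swap12: "fano_labelled i j k a b c d \<Longrightarrow> fano_labelled j i k a c b d"
  unfolding fano_labelled_def by (auto simp: insert_commute)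

lemma fano_labelled_swap23: "fano_labelled i j k a b c d \<Longrightarrow> fano_labelled i k j a b d c"
  unfolding fano_labelled_def by (auto simp: insert_commute)

lemma fano_labelled_shift: "fano_labelled i j k a b c d \<Longrightarrow> fano_labelled i a b c d j k"
  unfolding fano_labelled_def by (auto simp: insert_commute)

lemma fano_labelled_standard: "fano_labelled 1 2 3 4 5 6 7"
  unfolding fano_labelled_def fano_lines_def by simp

lemma fano_labelled_UNIV:
  assumes "fano_labelled i j k a b c d"
  shows "UNIV = {i, j, k, a, b, c, d}"
proof -
  have "card {i, j, k, a, b, c, d} = 7"
    using assms unfolding fano_labelled_def by simp
  then show ?thesis
    by (intro sym[OF card_subset_eq]) simp_all
qed

text \<open>
  The two relabellings above let the second point of a labelling become any point other than
  the first.
\<close>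

lemma fano_labelled_second:
  assumes "fano_labelled i j k a b c d" "l \<noteq> i"
  shows "\<exists>k a b c d. fano_labelled i l k a b c d"
proof -
  have "l \<in> {i, j, k, a, b, c, d}"
    using fano_labelled_UNIV[OF assms(1)] by blast
  with assms(2) consider "l = j" | "l = k" | "l = a" | "l = b" | "l = c" | "l = d" by blast
  then show ?thesis
    using assms(1) fano_labelled_swap23 fano_labelled_shift by cases metis+
qed

text \<open>
  The double transitivity of the automorphism group of the Fano plane, in the form in which it
  reduces the Rayleigh differences for all pairs of points to a single one.
\<close>

lemma ex_fano_labelled:
  assumes "i \<noteq> j"
  shows "\<exists>k a b c d. fano_labelled i j k a b c d"
proof -
  have "\<exists>j k a b c d. fano_labelled i j k a b c d"
    using fano_labelled_standard fano_labelled_swap12 fano_labelled_second by metis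
  then show ?thesis using fano_labelled_second assms by metis
qed

section \<open>Independent and spanning sets of the Fano matroid\<close>

text \<open>
  A set of two points extends to a basis by any point off the line through them.
\<close>

lemma indep_fano: "indep fano S \<longleftrightarrow> card S \<le> 3 \<and> S \<notin> fano_lines"
proof
  assume "indep fano S"
  then obtain B where B: "card B = 3" "B \<notin> fano_lines" "S \<subseteq> B"
    by (auto simp: indep_def bases_fano)
  then have "card S \<le> 3" using card_mono[of B S] by simp
  moreover have "S \<in> fano_lines \<Longrightarrow> S = B"
    using B fano_lines_card by (intro card_subset_eq) auto
  ultimately show "card S \<le> 3 \<and> S \<notin> fano_lines" using B by blast
next
  assume S: "card S \<le> 3 \<and> S \<notin> fano_lines"
  show "indep fano S"
  proof (cases "card S = 3")
    case True
    then show ?thesis using S by (auto simp: indep_def bases_fano)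
  next
    case False
    then obtain T where T: "S \<subseteq> T" "card T = 2"
      using S exists_subset_between[of S 2 UNIV] by auto
    then obtain a b where ab: "T = {a, b}" "a \<noteq> b" by (auto simp: card_2_iff)
    obtain L where L: "L \<in> fano_lines" "a \<in> L" "b \<in> L"
      using fano_lines_ex by blast
    have "L \<noteq> UNIV" using fano_lines_card[OF L(1)] by auto
    then obtain y where y: "y \<notin> L" by blast
    have "y \<noteq> a" "y \<noteq> b" using y L by auto
    then have "card {y, a, b} = 3" using ab by simp
    moreover have "{y, a, b} \<notin> fano_lines"
      using fano_lines_unique[OF L(1) _ L(2,3) _ _ ab(2)] y by blast
    ultimately show ?thesis
      using T(1) ab unfolding indep_def bases_fano
      by (intro bexI[of _ "{y, a, b}"]) auto
  qed
qed

lemma spanning_fano: "spanning fano S \<longleftrightarrow> 3 \<le> card S \<and> S \<notin> fano_lines"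
proof
  assume "spanning fano S"
  then obtain B where B: "card B = 3" "B \<notin> fano_lines" "B \<subseteq> S"
    by (auto simp: spanning_def bases_fano)
  then have "3 \<le> card S" using card_mono[of S B] by simp
  moreover have "S \<in> fano_lines \<Longrightarrow> B = S"
    using B fano_lines_card by (intro card_subset_eq) auto
  ultimately show "3 \<le> card S \<and> S \<notin> fano_lines" using B by blast
next
  assume S: "3 \<le> card S \<and> S \<notin> fano_lines"
  obtain T where T: "T \<subseteq> S" "card T = 3"
    by (rule obtain_subset_with_card_n[OF conjunct1[OF S]])
  show "spanning fano S"
  proof (cases "T \<in> fano_lines")
    case False
    then show ?thesis using T by (auto simp: spanning_def bases_fano)
  next
    case True
    then have "T \<noteq> S" using S by blast
    then obtain y where y: "y \<in> S" "y \<notin> T" using T(1) by blast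
    obtain a b where ab: "a \<in> T" "b \<in> T" "a \<noteq> b"
      using T(2) by (auto simp: card_3_iff)
    have "y \<noteq> a" "y \<noteq> b" using y ab by auto
    then have "card {y, a, b} = 3" using ab by simp
    moreover have "{y, a, b} \<notin> fano_lines"
      using fano_lines_unique[OF True _ ab(1,2) _ _ ab(3)] y by blast
    ultimately show ?thesis
      using y ab T unfolding spanning_def bases_fano
      by (intro bexI[of _ "{y, a, b}"]) auto
  qed
qed

section \<open>Matroid polynomials and duality\<close>

lemma sum_mono_prod_eq_mapoly: "(\<Sum>T | Q T. mono_prod T w) = mapoly (\<lambda>T. of_bool (Q T)) w"
  unfolding mapoly_def by (rule sum.mono_neutral_cong_left) auto

lemma C_poly_eq_mapoly: "C_poly M = mapoly (\<lambda>T. of_bool (indep M (- T)))"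
  by (simp add: fun_eq_iff C_poly_def sum_mono_prod_eq_mapoly)

lemma S_poly_eq_mapoly: "S_poly M = mapoly (\<lambda>T. of_bool (spanning M T))"
  by (simp add: fun_eq_iff S_poly_def sum_mono_prod_eq_mapoly)

lemma I_poly_eq_mapoly: "I_poly M = mapoly (\<lambda>T. of_bool (indep M T))"
  by (simp add: fun_eq_iff I_poly_def sum_mono_prod_eq_mapoly)

lemma B_poly_eq_mapoly: "B_poly M = mapoly (\<lambda>T. of_bool (T \<in> bases M))"
  using sum_mono_prod_eq_mapoly[where Q = "\<lambda>T. T \<in> bases M"] by (simp add: fun_eq_iff B_poly_def)

lemma mem_bases_dual: "T \<in> bases (dual M) \<longleftrightarrow> - T \<in> bases M"
  unfolding bases_dual by (metis (no_types, lifting) double_complement image_iff)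

text \<open>
  By this duality the spanning polynomial of a matroid is the cospanning polynomial of its
  dual; in particular both Garding claims on \<open>C\<close> and \<open>S\<close> concern the same polynomial.
\<close>

lemma spanning_dual: "spanning (dual M) T \<longleftrightarrow> indep M (- T)"
proof -
  have "- B \<subseteq> T \<longleftrightarrow> - T \<subseteq> B" for B by auto
  then show ?thesis by (simp add: spanning_def indep_def bases_dual)
qed

lemma dual_dual: "dual (dual M) = M"
  by (simp add: bases_inject[symmetric] bases_dual image_image)

lemma C_poly_dual: "C_poly (dual M) = S_poly M"
  using spanning_dual[of "dual M"] by (simp add: C_poly_eq_mapoly S_poly_eq_mapoly dual_dual)

lemma S_poly_dual: "S_poly (dual M) = C_poly M"
  using C_poly_dual[of "dual M"] by (simp add: dual_dual)

text \<open>
  The independence polynomial is the reversal of the cospanning polynomial.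
\<close>

lemma rayleigh_I_poly:
  assumes "rayleigh (C_poly M)"
  shows "rayleigh (I_poly M)"
  using rayleigh_reverse[of "\<lambda>T. of_bool (indep M (- T))"] assms
  by (simp add: C_poly_eq_mapoly I_poly_eq_mapoly)

text \<open>
  Complementation of bases reverses the basis polynomial.
\<close>

lemma rayleigh_B_poly:
  assumes "rayleigh (B_poly (dual M))"
  shows "rayleigh (B_poly M)"
  using rayleigh_reverse[of "\<lambda>T. of_bool (T \<in> bases (dual M))"] assms
  by (simp add: B_poly_eq_mapoly mem_bases_dual)

section \<open>Expansions of the Fano polynomials at a pair of points\<close>

text \<open>
  A sum whose coefficients only depend on cardinalities can be expanded one point at a time.
  Each of the three polynomials is such a sum minus a sum over the seven lines.
\<close>

definition cardsum :: "(nat \<Rightarrow> real) \<Rightarrow> 'n set \<Rightarrow> real ^ 'n::finite \<Rightarrow> real"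
  where "cardsum g S w = (\<Sum>T\<in>Pow S. g (card T) * mono_prod T w)"

lemma cardsum_empty: "cardsum g {} w = g 0"
  by (simp add: cardsum_def mono_prod_def)

lemma cardsum_insert:
  assumes "e \<notin> S"
  shows "cardsum g (insert e S) w = cardsum g S w + w $ e * cardsum (\<lambda>n. g (Suc n)) S w"
proof -
  have "cardsum g (insert e S) w = cardsum g S w + (\<Sum>T\<in>insert e ` Pow S. g (card T) * mono_prod T w)"
    unfolding cardsum_def Pow_insert using assms by (intro sum.union_disjoint) auto
  also have "(\<Sum>T\<in>insert e ` Pow S. g (card T) * mono_prod T w)
      = (\<Sum>T\<in>Pow S. g (card (insert e T)) * mono_prod (insert e T) w)"
    using assms by (intro sum.reindex_cong[of "insert e"]) (auto simp: inj_on_def)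
  also have "\<dots> = w $ e * cardsum (\<lambda>n. g (Suc n)) S w"
    unfolding cardsum_def sum_distrib_left
  proof (rule sum.cong)
    fix T assume "T \<in> Pow S"
    then have "e \<notin> T" using assms by blast
    then show "g (card (insert e T)) * mono_prod (insert e T) w = w $ e * (g (Suc (card T)) * mono_prod T w)"
      by (simp add: mono_prod_def)
  qed simp
  finally show ?thesis .
qed

text \<open>
  Sums over the lines become explicit; what needs proof is that the seven lines of a labelling
  are pairwise different.
\<close>

lemma sum_fano_lines:
  assumes "fano_labelled i j k a b c d"
  shows "(\<Sum>L\<in>fano_lines. h L) = (h {i, j, k} + h {i, a, b} + h {i, c, d} + h {j, a, c} + h {j, b, d}
    + h {k, a, d} + h {k, b, c} :: real)"
proof -
  let ?Ls = "[{i, j, k}, {i, a, b}, {i, c, d}, {j, a, c}, {j, b, d}, {k, a, d}, {k, b, c}]"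
  have lines: "fano_lines = set ?Ls" and dist: "distinct [i, j, k, a, b, c, d]"
    using assms by (auto simp: fano_labelled_def)
  \<comment> \<open>Four membership bits already tell the seven lines apart.\<close>
  have "distinct (map (\<lambda>L. (i \<in> L, j \<in> L, k \<in> L, a \<in> L)) ?Ls)"
    using dist by auto
  then have "distinct ?Ls"
    unfolding distinct_map by (rule conjunct1)
  then have "(\<Sum>L\<in>set ?Ls. h L) = sum_list (map h ?Ls)"
    by (rule sum.distinct_set_conv_list)
  then show ?thesis unfolding lines by simp
qed

lemma card_Compl_7: "card (- T) = 7 - card T" for T :: "7 set"
  by (simp add: Compl_eq_Diff_UNIV card_Diff_subset)

lemma card_le_7: "card T \<le> 7" for T :: "7 set"
  using card_mono[of UNIV T] by simp

lemma sum_of_bool_lines_compl: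
  "(\<Sum>T\<in>UNIV. of_bool (- T \<in> fano_lines) * mono_prod T w) = (\<Sum>L\<in>fano_lines. mono_prod (- L) w)"
proof -
  have "(\<Sum>T\<in>UNIV. of_bool (- T \<in> fano_lines) * mono_prod T w) = (\<Sum>T | - T \<in> fano_lines. mono_prod T w)"
    by (rule sum.mono_neutral_cong_right) auto
  also have "\<dots> = (\<Sum>L\<in>fano_lines. mono_prod (- L) w)"
    by (rule sum.reindex_bij_witness[of _ uminus uminus]) auto
  finally show ?thesis .
qed

lemma C_poly_fano_cardsum:
  "C_poly fano w = cardsum (\<lambda>n. of_bool (4 \<le> n)) UNIV w - (\<Sum>L\<in>fano_lines. mono_prod (- L) w)"
proof -
  have "of_bool (indep fano (- T)) = of_bool (4 \<le> card T) - (of_bool (- T \<in> fano_lines) :: real)" for T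
    using fano_lines_card[of "- T"] card_le_7[of T] unfolding indep_fano card_Compl_7 by auto
  then show ?thesis
    unfolding C_poly_eq_mapoly mapoly_def cardsum_def sum_of_bool_lines_compl[symmetric]
    by (simp add: left_diff_distrib sum_subtractf)
qed

lemma B_poly_dual_fano_cardsum:
  "B_poly (dual fano) w = cardsum (\<lambda>n. of_bool (n = 4)) UNIV w - (\<Sum>L\<in>fano_lines. mono_prod (- L) w)"
proof -
  have "of_bool (T \<in> bases (dual fano)) = of_bool (card T = 4) - (of_bool (- T \<in> fano_lines) :: real)" for T
    using fano_lines_card[of "- T"] card_le_7[of T] unfolding mem_bases_dual bases_fano mem_Collect_eq card_Compl_7 by auto
  then show ?thesis
    unfolding B_poly_eq_mapoly mapoly_def cardsum_def sum_of_bool_lines_compl[symmetric]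
    by (simp add: left_diff_distrib sum_subtractf)
qed

lemma S_poly_fano_cardsum:
  "S_poly fano w = cardsum (\<lambda>n. of_bool (3 \<le> n)) UNIV w - (\<Sum>L\<in>fano_lines. mono_prod L w)"
proof -
  have "of_bool (spanning fano T) = of_bool (3 \<le> card T) - (of_bool (T \<in> fano_lines) :: real)" for T
    using fano_lines_card[of T] unfolding spanning_fano by auto
  moreover have "(\<Sum>T\<in>UNIV. of_bool (T \<in> fano_lines) * mono_prod T w) = (\<Sum>L\<in>fano_lines. mono_prod L w)"
    by (rule sum.mono_neutral_cong_right) auto
  ultimately show ?thesis
    unfolding S_poly_eq_mapoly mapoly_def cardsum_def
    by (simp add: left_diff_distrib sum_subtractf)
qed

lemma fano_labelled_compl:
  assumes "fano_labelled i j k a b c d"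
  shows "- {i, j, k} = {a, b, c, d}" "- {i, a, b} = {j, k, c, d}" "- {i, c, d} = {j, k, a, b}"
    "- {j, a, c} = {i, k, b, d}" "- {j, b, d} = {i, k, a, c}"
    "- {k, a, d} = {i, j, b, c}" "- {k, b, c} = {i, j, a, d}"
  using assms
  by (intro compl_unique; auto simp: fano_labelled_def fano_labelled_UNIV[OF assms])+

text \<open>
  The sum of the third and the fourth elementary symmetric polynomial, grouped by the pairs
  \<open>{a, d}\<close> and \<open>{b, c}\<close>.
\<close>

definition esym34 :: "real \<Rightarrow> real \<Rightarrow> real \<Rightarrow> real \<Rightarrow> real"
  where "esym34 a b c d = a * d * (b + c) + b * c * (a + d) + a * d * (b * c)"

lemma C_poly_fano_expand:
  fixes w :: "real ^ 7"
  assumes "fano_labelled i j k a b c d"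
  shows "C_poly fano w =
    w$k * esym34 (w$a) (w$b) (w$c) (w$d)
    + (esym34 (w$a) (w$b) (w$c) (w$d)
        + w$k * ((w$a + w$c) * (w$b + w$d) + esym34 (w$a) (w$b) (w$c) (w$d))) * w$i
    + (esym34 (w$a) (w$b) (w$c) (w$d)
        + w$k * ((w$a + w$b) * (w$c + w$d) + esym34 (w$a) (w$b) (w$c) (w$d))) * w$j
    + ((w$a + w$d + w$a * w$d) * (w$b + w$c + w$b * w$c) * (1 + w$k)
        + w$k * (w$a + w$d + w$a * w$d + (w$b + w$c + w$b * w$c))) * (w$i * w$j)"
proof -
  have "distinct [i, j, k, a, b, c, d]"
    using assms by (simp add: fano_labelled_def)
  then show ?thesis
    unfolding C_poly_fano_cardsum sum_fano_lines[OF assms] fano_labelled_compl[OF assms]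
      fano_labelled_UNIV[OF assms]
    by (simp add: cardsum_insert cardsum_empty mono_prod_def esym34_def algebra_simps)
qed

lemma B_poly_dual_fano_expand:
  fixes w :: "real ^ 7"
  assumes "fano_labelled i j k a b c d"
  defines "g \<equiv> \<lambda>w :: real ^ 7. w$a * w$d * (w$b + w$c) + w$b * w$c * (w$a + w$d)"
  shows "B_poly (dual fano) w = w$k * g w
    + (g w + w$k * ((w$a + w$c) * (w$b + w$d))) * w$i
    + (g w + w$k * ((w$a + w$b) * (w$c + w$d))) * w$j
    + ((w$a + w$d) * (w$b + w$c) + w$k * (w$a + w$d + (w$b + w$c))) * (w$i * w$j)"
proof -
  have "distinct [i, j, k, a, b, c, d]"
    using assms by (simp add: fano_labelled_def)
  then show ?thesis
    unfolding B_poly_dual_fano_cardsum sum_fano_lines[OF assms(1)] fano_labelled_compl[OF assms(1)]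
      fano_labelled_UNIV[OF assms(1)]
    by (simp add: cardsum_insert cardsum_empty mono_prod_def g_def algebra_simps)
qed

lemma S_poly_fano_expand:
  fixes w :: "real ^ 7"
  assumes "fano_labelled i j k a b c d"
  defines "G \<equiv> \<lambda>w :: real ^ 7. esym34 (w$a) (w$b) (w$c) (w$d)"
    and "Z \<equiv> \<lambda>w :: real ^ 7. (1 + w$a) * (1 + w$b) * (1 + w$c) * (1 + w$d) - 1"
  shows "S_poly fano w = G w + w$k * ((w$a + w$d) * (w$b + w$c) + G w)
    + (w$k * Z w + (w$a + w$b) * (w$c + w$d) + G w) * w$i
    + (w$k * Z w + (w$a + w$c) * (w$b + w$d) + G w) * w$j
    + (1 + w$k) * Z w * (w$i * w$j)"
proof -
  have "distinct [i, j, k, a, b, c, d]"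
    using assms by (simp add: fano_labelled_def)
  then show ?thesis
    unfolding S_poly_fano_cardsum sum_fano_lines[OF assms(1)]
      fano_labelled_UNIV[OF assms(1)]
    by (simp add: cardsum_insert cardsum_empty mono_prod_def G_def Z_def esym34_def algebra_simps)
qed

section \<open>Rayleigh differences of the Fano polynomials\<close>

text \<open>
  The Rayleigh difference of \<open>A + B w\<^sub>i + C w\<^sub>j + D w\<^sub>i w\<^sub>j\<close> no longer involves \<open>w\<^sub>i\<close> and \<open>w\<^sub>j\<close>.
\<close>

lemma rayleigh_diff_of_expansion:
  fixes w :: "real ^ 'n::finite"
  assumes ij: "i \<noteq> j"
    and f: "\<And>v. mapoly c v = A v + B v * v$i + C v * v$j + D v * (v$i * v$j)"
    and inv: "\<And>F v l. F \<in> {A, B, C, D} \<Longrightarrow> l \<in> {i, j} \<Longrightarrow> F (v + axis l 1) = F v"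
  shows "rayleigh_diff c i j w = B w * C w - A w * D w" and "mapoly (dcoef {i, j} c) w = D w"
proof -
  have ax: "axis i (1::real) $ i = 1" "axis j (1::real) $ j = 1"
      "axis i (1::real) $ j = 0" "axis j (1::real) $ i = 0"
    using ij by (auto simp: axis_def)
  have inv': "F (v + axis i 1) = F v" "F (v + axis j 1) = F v" if "F = A \<or> F = B \<or> F = C \<or> F = D" for F v
    using that by (auto intro: inv)
  note inv'[of A, simplified, simp] inv'[of B, simplified, simp]
    inv'[of C, simplified, simp] inv'[of D, simplified, simp]
  have i: "mapoly (dcoef {i} c) w = B w + D w * w$j"
    by (simp add: mapoly_dcoef_singleton f ax algebra_simps)
  have j: "mapoly (dcoef {j} c) w = C w + D w * w$i"
    by (simp add: mapoly_dcoef_singleton f ax algebra_simps)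
  show D: "mapoly (dcoef {i, j} c) w = D w"
    by (simp add: mapoly_dcoef_pair[OF ij] f ax) (simp add: algebra_simps)
  show "rayleigh_diff c i j w = B w * C w - A w * D w"
    unfolding rayleigh_diff_def i j D f by (simp add: algebra_simps)
qed

text \<open>
  A nonzero coefficient at the full product keeps every iterated derivative from vanishing.
\<close>

lemma garding_cone_pos:
  assumes "w \<in> garding_cone c" "c UNIV \<noteq> 0"
  shows "0 < mapoly (dcoef T c) w"
proof -
  have "dcoef T c (- T) \<noteq> 0" using assms(2) by (simp add: dcoef_def)
  then have "dcoef T c \<noteq> (\<lambda>U. 0)" by metis
  then show ?thesis using assms(1) by (simp add: garding_cone_def)
qed

lemma garding_cone_nonneg:
  assumes "w \<in> garding_cone c"
  shows "0 \<le> mapoly (dcoef T c) w"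
proof (cases "dcoef T c = (\<lambda>U. 0)")
  case True
  show ?thesis unfolding True by simp
next
  case False
  then show ?thesis using assms by (simp add: garding_cone_def less_imp_le)
qed

text \<open>
  Differentiating in all variables but one leaves an affine function of that variable; for the
  cospanning polynomial it is \<open>1 + w\<^sub>e\<close>, which bounds all coordinates below by \<open>- 1\<close> on the cone.
\<close>

lemma mapoly_dcoef_Compl_singleton: "mapoly (dcoef (- {e}) c) w = c (- {e}) + c UNIV * w $ e"
proof -
  have "mapoly (dcoef (- {e}) c) w = (\<Sum>U\<in>{{}, {e}}. dcoef (- {e}) c U * mono_prod U w)"
    unfolding mapoly_def by (rule sum.mono_neutral_right) (auto simp: dcoef_def)
  also have "\<dots> = c (- {e}) + c UNIV * w $ e"
  proof -
    have "insert e (- {e}) = UNIV" by auto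
    then show ?thesis by (simp add: dcoef_def mono_prod_def)
  qed
  finally show ?thesis .
qed

lemma rayleigh_diff_C_poly_fano_nonneg:
  fixes w :: "real ^ 7"
  defines "coef \<equiv> \<lambda>T. of_bool (indep fano (- T)) :: real"
  assumes w: "w \<in> garding_cone coef" and "i \<noteq> j"
  shows "0 \<le> rayleigh_diff coef i j w"
proof -
  obtain k a b c d where lab: "fano_labelled i j k a b c d"
    using ex_fano_labelled[OF \<open>i \<noteq> j\<close>] by blast
  then have dist: "distinct [i, j, k, a, b, c, d]"
    by (simp add: fano_labelled_def)
  have UNIV: "coef UNIV \<noteq> 0"
    by (simp add: coef_def indep_fano) (use fano_lines_card[of "{}"] in auto)
  have v: "0 < 1 + w $ e" for e
  proof -
    have "coef (- {e}) = 1" "coef UNIV = 1"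
      using fano_lines_card[of "{e}"] fano_lines_card[of "{}"] by (auto simp: coef_def indep_fano)
    then show ?thesis
      using garding_cone_pos[OF w UNIV, of "- {e}"] by (simp add: mapoly_dcoef_Compl_singleton)
  qed
  let ?G = "\<lambda>v :: real ^ 7. esym34 (v$a) (v$b) (v$c) (v$d)"
  let ?p = "\<lambda>v :: real ^ 7. v$a + v$d + v$a * v$d" and ?q = "\<lambda>v :: real ^ 7. v$b + v$c + v$b * v$c"
  let ?D = "\<lambda>v :: real ^ 7. ?p v * ?q v * (1 + v$k) + v$k * (?p v + ?q v)"
  let ?A = "\<lambda>v :: real ^ 7. v$k * ?G v"
  let ?B = "\<lambda>v :: real ^ 7. ?G v + v$k * ((v$a + v$c) * (v$b + v$d) + ?G v)"
  let ?C = "\<lambda>v :: real ^ 7. ?G v + v$k * ((v$a + v$b) * (v$c + v$d) + ?G v)"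
  have f: "mapoly coef v = ?A v + ?B v * v$i + ?C v * v$j + ?D v * (v$i * v$j)" for v
    unfolding coef_def C_poly_eq_mapoly[symmetric] using C_poly_fano_expand[OF lab] .
  have ax: "axis i (1::real) $ n = 0" "axis j (1::real) $ n = 0" if "n \<in> {k, a, b, c, d}" for n
    using that dist by (auto simp: axis_def)
  have expansion: "rayleigh_diff coef i j v = ?B v * ?C v - ?A v * ?D v"
      "mapoly (dcoef {i, j} coef) v = ?D v" for v
    by (rule rayleigh_diff_of_expansion[OF \<open>i \<noteq> j\<close> f]; auto simp: ax)+
  have diff: "rayleigh_diff coef i j v = cospan_disc (v$k) (v$a + v$d) (v$b + v$c) (v$a * v$d) (v$b * v$c)" for v
    unfolding expansion by (simp add: cospan_disc_def esym34_def power2_eq_square algebra_simps)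
  have bc: "mapoly (dcoef {b, c} (dcoef {i, j} coef)) w = ?p w * (1 + w$k) + w$k"
  proof (rule rayleigh_diff_of_expansion(2))
    show "mapoly (dcoef {i, j} coef) v = v$k * ?p v + (?p v * (1 + v$k) + v$k) * v$b
        + (?p v * (1 + v$k) + v$k) * v$c + (?p v * (1 + v$k) + v$k) * (v$b * v$c)" for v
      unfolding expansion by (simp add: algebra_simps)
  qed (use dist in \<open>auto simp: axis_def\<close>)
  have ad: "mapoly (dcoef {a, d} (dcoef {i, j} coef)) w = ?q w * (1 + w$k) + w$k"
  proof (rule rayleigh_diff_of_expansion(2))
    show "mapoly (dcoef {i, j} coef) v = v$k * ?q v + (?q v * (1 + v$k) + v$k) * v$a
        + (?q v * (1 + v$k) + v$k) * v$d + (?q v * (1 + v$k) + v$k) * (v$a * v$d)" for v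
      unfolding expansion by (simp add: algebra_simps)
  qed (use dist in \<open>auto simp: axis_def\<close>)
  \<comment> \<open>The two derivatives of order four just computed are \<open>(1 + x) (1 + a) (1 + d) - 1\<close> and
    \<open>(1 + x) (1 + b) (1 + c) - 1\<close>, the first two quantities of the inequality.\<close>
  have "dcoef {b, c} (dcoef {i, j} coef) = dcoef {b, c, i, j} coef"
    "dcoef {a, d} (dcoef {i, j} coef) = dcoef {a, d, i, j} coef"
    using dist by (simp_all add: dcoef_dcoef insert_commute)
  then have \<alpha>: "0 \<le> ?p w * (1 + w$k) + w$k" and \<beta>: "0 \<le> ?q w * (1 + w$k) + w$k"
    using garding_cone_nonneg[OF w, of "{b, c, i, j}"] garding_cone_nonneg[OF w, of "{a, d, i, j}"] bc ad
    by simp_all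
  have "0 \<le> ?D w"
    using garding_cone_nonneg[OF w, of "{i, j}"] expansion(2) by simp
  then show ?thesis
    unfolding diff using v \<alpha> \<beta>
    by (intro cospanning_rayleigh_inequality) (simp_all add: algebra_simps)
qed

text \<open>
  Put \<open>U = a d\<close>, \<open>V = b c\<close>, \<open>p = a + d + x\<close> and \<open>q = b + c + x\<close>, where \<open>x\<close> is the weight of the third point,
  and let \<open>D = p q - x\<^sup>2\<close> be the coefficient of \<open>w\<^sub>i w\<^sub>j\<close>. The difference is
  \<open>(U q + V p)\<^sup>2 - 4 x\<^sup>2 U V = (U q - V p)\<^sup>2 + 4 D U V\<close>: the first form settles \<open>U V \<le> 0\<close>, and the second
  one \<open>U V > 0\<close>, since \<open>D \<ge> 0\<close> on the cone.
\<close>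

lemma rayleigh_diff_B_poly_dual_fano_nonneg:
  fixes w :: "real ^ 7"
  defines "coef \<equiv> \<lambda>T. of_bool (T \<in> bases (dual fano)) :: real"
  assumes w: "w \<in> garding_cone coef" and "i \<noteq> j"
  shows "0 \<le> rayleigh_diff coef i j w"
proof -
  obtain k a b c d where lab: "fano_labelled i j k a b c d"
    using ex_fano_labelled[OF \<open>i \<noteq> j\<close>] by blast
  then have dist: "distinct [i, j, k, a, b, c, d]"
    by (simp add: fano_labelled_def)
  let ?G = "\<lambda>v :: real ^ 7. v$a * v$d * (v$b + v$c) + v$b * v$c * (v$a + v$d)"
  let ?D = "\<lambda>v :: real ^ 7. (v$a + v$d) * (v$b + v$c) + v$k * (v$a + v$d + (v$b + v$c))"
  let ?A = "\<lambda>v :: real ^ 7. v$k * ?G v"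
  let ?B = "\<lambda>v :: real ^ 7. ?G v + v$k * ((v$a + v$c) * (v$b + v$d))"
  let ?C = "\<lambda>v :: real ^ 7. ?G v + v$k * ((v$a + v$b) * (v$c + v$d))"
  have f: "mapoly coef v = ?A v + ?B v * v$i + ?C v * v$j + ?D v * (v$i * v$j)" for v
    unfolding coef_def B_poly_eq_mapoly[symmetric] using B_poly_dual_fano_expand[OF lab] .
  have ax: "axis i (1::real) $ n = 0" "axis j (1::real) $ n = 0" if "n \<in> {k, a, b, c, d}" for n
    using that dist by (auto simp: axis_def)
  have expansion: "rayleigh_diff coef i j v = ?B v * ?C v - ?A v * ?D v"
      "mapoly (dcoef {i, j} coef) v = ?D v" for v
    by (rule rayleigh_diff_of_expansion[OF \<open>i \<noteq> j\<close> f]; auto simp: ax)+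
  define U V q p where "U = w$a * w$d" "V = w$b * w$c" "q = w$b + w$c + w$k" "p = w$a + w$d + w$k"
  note defs = this
  have "rayleigh_diff coef i j w = (U * q + V * p)\<^sup>2 - 4 * (w$k)\<^sup>2 * (U * V)"
    unfolding expansion by (simp add: defs power2_eq_square algebra_simps)
  moreover have "0 \<le> (U * q + V * p)\<^sup>2 - 4 * (w$k)\<^sup>2 * (U * V)"
  proof (cases "U * V \<le> 0")
    case True
    then have "4 * (w$k)\<^sup>2 * (U * V) \<le> 0" by (intro mult_nonneg_nonpos[of "4 * (w$k)\<^sup>2"]) auto
    moreover have "0 \<le> (U * q + V * p)\<^sup>2" by simp
    ultimately show ?thesis by linarith
  next
    case False
    have "0 \<le> ?D w"
      using garding_cone_nonneg[OF w, of "{i, j}"] expansion(2) by simp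
    then have "0 \<le> ?D w * (U * V)"
      using False by (intro mult_nonneg_nonneg[of "?D w"]) auto
    then have "0 \<le> (U * q - V * p)\<^sup>2 + 4 * (?D w * (U * V))"
      by (intro add_nonneg_nonneg zero_le_power2) linarith
    also have "\<dots> = (U * q + V * p)\<^sup>2 - 4 * (w$k)\<^sup>2 * (U * V)"
      by (simp add: defs power2_eq_square algebra_simps)
    finally show ?thesis .
  qed
  ultimately show ?thesis by simp
qed

text \<open>
  On the positive orthant this difference is visibly nonnegative once the products of its
  coefficients are collected by powers of the weight of the third point.
\<close>

lemma rayleigh_S_poly_fano: "rayleigh (S_poly fano)"
proof -
  let ?coef = "\<lambda>T. of_bool (spanning fano T) :: real"
  have "0 \<le> rayleigh_diff ?coef i j w" if ij: "i \<noteq> j" and w: "w \<in> pos_orthant" for i j w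
  proof -
    obtain k a b c d where lab: "fano_labelled i j k a b c d"
      using ex_fano_labelled[OF ij] by blast
    then have dist: "distinct [i, j, k, a, b, c, d]"
      by (simp add: fano_labelled_def)
    let ?G = "\<lambda>v :: real ^ 7. esym34 (v$a) (v$b) (v$c) (v$d)"
    let ?Z = "\<lambda>v :: real ^ 7. (1 + v$a) * (1 + v$b) * (1 + v$c) * (1 + v$d) - 1"
    let ?A = "\<lambda>v :: real ^ 7. ?G v + v$k * ((v$a + v$d) * (v$b + v$c) + ?G v)"
    let ?B = "\<lambda>v :: real ^ 7. v$k * ?Z v + (v$a + v$b) * (v$c + v$d) + ?G v"
    let ?C = "\<lambda>v :: real ^ 7. v$k * ?Z v + (v$a + v$c) * (v$b + v$d) + ?G v"
    let ?D = "\<lambda>v :: real ^ 7. (1 + v$k) * ?Z v"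
    have f: "mapoly ?coef v = ?A v + ?B v * v$i + ?C v * v$j + ?D v * (v$i * v$j)" for v
      unfolding S_poly_eq_mapoly[symmetric] using S_poly_fano_expand[OF lab] .
    have ax: "axis i (1::real) $ n = 0" "axis j (1::real) $ n = 0" if "n \<in> {k, a, b, c, d}" for n
      using that dist by (auto simp: axis_def)
    have expansion: "rayleigh_diff ?coef i j w = ?B w * ?C w - ?A w * ?D w"
      by (rule rayleigh_diff_of_expansion[OF ij f]; auto simp: ax)
    define U V q p where "U = w$a * w$d" "V = w$b * w$c" "q = w$b + w$c" "p = w$a + w$d"
    note defs = this
    have collect: "(x * Z + P + G) * (x * Z + Q + G) - (G + x * (R + G)) * ((1 + x) * Z)
        = x\<^sup>2 * (Z * (Z - R - G)) + x * (Z * (P + Q - R)) + ((P + G) * (Q + G) - G * Z)"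
      for x Z P Q R G :: real
      by (simp add: power2_eq_square algebra_simps)
    define P Q R where "P = (w$a + w$b) * (w$c + w$d)" "Q = (w$a + w$c) * (w$b + w$d)"
      "R = (w$a + w$d) * (w$b + w$c)"
    note PQR = this
    have "rayleigh_diff ?coef i j w = (w$k)\<^sup>2 * (?Z w * (?Z w - R - ?G w))
        + w$k * (?Z w * (P + Q - R)) + ((P + ?G w) * (Q + ?G w) - ?G w * ?Z w)"
      unfolding expansion PQR by (rule collect)
    also have "?Z w - R - ?G w = p + q + (U + V)"
      by (simp add: defs PQR esym34_def algebra_simps)
    also have "P + Q - R = 2 * (U + V)"
      by (simp add: defs PQR algebra_simps)
    also have "(P + ?G w) * (Q + ?G w) - ?G w * ?Z w = (U - V)\<^sup>2 + U\<^sup>2 * (q + V) + V\<^sup>2 * (p + U)"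
      by (simp add: defs PQR esym34_def power2_eq_square algebra_simps)
    finally have eq: "rayleigh_diff ?coef i j w = (w$k)\<^sup>2 * (?Z w * (p + q + (U + V)))
        + w$k * (?Z w * (2 * (U + V))) + ((U - V)\<^sup>2 + U\<^sup>2 * (q + V) + V\<^sup>2 * (p + U))" .
    show ?thesis
    proof -
      have pos: "0 < w $ e" for e using w by (simp add: pos_orthant_def)
      have "1 * 1 * 1 * 1 \<le> (1 + w$a) * (1 + w$b) * (1 + w$c) * (1 + w$d)"
        using pos[of a] pos[of b] pos[of c] pos[of d] by (intro mult_mono mult_nonneg_nonneg) auto
      then have "0 \<le> ?Z w" by simp
      moreover have "0 \<le> U" "0 \<le> V" "0 \<le> p" "0 \<le> q" "0 \<le> w$k"
        using pos[of a] pos[of b] pos[of c] pos[of d] pos[of k] by (simp_all add: defs)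
      ultimately show ?thesis
        unfolding eq by (intro add_nonneg_nonneg mult_nonneg_nonneg) auto
    qed
  qed
  then show ?thesis
    unfolding S_poly_eq_mapoly by (simp add: rayleigh_mapoly_iff)
qed

lemma garding_rayleigh_C_poly_fano: "garding (C_poly fano)" "rayleigh (C_poly fano)"
proof -
  let ?coef = "\<lambda>T. of_bool (indep fano (- T)) :: real"
  have "?coef UNIV \<noteq> 0"
    using fano_lines_card[of "{}"] by (auto simp: indep_fano)
  then have nz: "?coef \<noteq> (\<lambda>T. 0)" by metis
  show "garding (C_poly fano)"
    unfolding C_poly_eq_mapoly using nz rayleigh_diff_C_poly_fano_nonneg
    by (intro garding_mapoly) auto
  show "rayleigh (C_poly fano)"
    unfolding C_poly_eq_mapoly
    using rayleigh_diff_C_poly_fano_nonneg pos_orthant_subset_garding_cone[of ?coef]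
    by (subst rayleigh_mapoly_iff) auto
qed

lemma garding_rayleigh_B_poly_dual_fano: "garding (B_poly (dual fano))" "rayleigh (B_poly (dual fano))"
proof -
  let ?coef = "\<lambda>T. of_bool (T \<in> bases (dual fano)) :: real"
  obtain B where "B \<in> bases (dual fano)" using bases_nonempty by blast
  then have "?coef B \<noteq> 0" by simp
  then have nz: "?coef \<noteq> (\<lambda>T. 0)" by metis
  show "garding (B_poly (dual fano))"
    unfolding B_poly_eq_mapoly using nz rayleigh_diff_B_poly_dual_fano_nonneg
    by (intro garding_mapoly) auto
  show "rayleigh (B_poly (dual fano))"
    unfolding B_poly_eq_mapoly
    using rayleigh_diff_B_poly_dual_fano_nonneg pos_orthant_subset_garding_cone[of ?coef]
    by (subst rayleigh_mapoly_iff) auto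
qed

theorem theorem14p11:
  shows "garding (C_poly fano)
    \<and> (garding (S_poly (dual fano)) \<and> garding (B_poly (dual fano)))
    \<and> (\<forall>M\<in>{fano, dual fano}.
          rayleigh (C_poly M) \<and> rayleigh (S_poly M) \<and> rayleigh (B_poly M) \<and> rayleigh (I_poly M))"
proof -
  have "rayleigh (C_poly (dual fano))"
    using rayleigh_S_poly_fano by (simp add: C_poly_dual)
  then show ?thesis
    using garding_rayleigh_C_poly_fano garding_rayleigh_B_poly_dual_fano rayleigh_S_poly_fano
      rayleigh_B_poly[of fano] rayleigh_I_poly[of fano] rayleigh_I_poly[of "dual fano"]
    by (simp add: C_poly_dual S_poly_dual)
qed

end
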